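(* Let $q$ be a prime power, let $\mathcal{X}=Z(f_{\mathcal{X}})$ be a degenerate quadric in $\mathbb{P}^4(\mathbb{F}_q)$, and let $\mathcal{Q}=Z(f)$ be a quadric in $\mathbb{P}^4(\mathbb{F}_q)$, where $f$ is a nonzero form of degree 2 which is not a scalar multiple of $f_{\mathcal{X}}$. (1) If $\mathcal{X}$ has rank 3, then $$\#(\mathcal{X}\cap\mathcal{Q})(\mathbb{F}_q)=4q^2+q+1\quad\text{or}\quad\#(\mathcal{X}\cap\mathcal{Q})(\mathbb{F}_q)\le 3q^2+q+1.$$ (2) If $\mathcal{X}$ has rank 4 and projective index $g(\mathcal{X})=2$, then $$\#(\mathcal{X}\cap\mathcal{Q})(\mathbb{F}_q)=4q^2+1\quad\text{or}\quad\#(\mathcal{X}\cap\mathcal{Q})(\mathbb{F}_q)\le 3q^2+q+1.$$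
   Context: A quadric in $\mathbb{P}^4(\mathbb{F}_q)$ is the zero set $Z(f)$ of a nonzero form $f$ of degree 2 in $x_0,\dots,x_4$ over $\mathbb{F}_q$. Its rank is the smallest number of indeterminates appearing in $f$ after an invertible linear change of coordinates; it is degenerate if its rank is less than 5. The projective index $g(\mathcal{X})$ is the maximum dimension of a linear subspace (over $\mathbb{F}_q$) contained in $\mathcal{X}$. A rank 3 quadric is a cone $\Pi_1\mathcal{P}_2$ with vertex a line over a non-degenerate plane conic; a rank 4 quadric with projective index 2 is a cone $\Pi_0\mathcal{H}_3$ with vertex a point over a hyperbolic quadric of $\mathbb{P}^3(\mathbb{F}_q)$. *)

theory Defs
  imports "HOL-Analysis.Analysis" "HOL-Library.Poly_Mapping"
begin

text \<open>
  Polynomials are formal, not polynomial functions: a monomial is a finitely supported exponent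
  vector on the index type of the indeterminates, and a polynomial maps finitely many monomials
  to nonzero coefficients. The ring structure is the convolution product of
  \<^theory>\<open>HOL-Library.Poly_Mapping\<close>.
\<close>

type_synonym ('a, 'n) mvpoly = "('n \<Rightarrow>\<^sub>0 nat) \<Rightarrow>\<^sub>0 'a"

definition Const :: "'a::zero \<Rightarrow> ('a, 'n) mvpoly" where
  "Const c = Poly_Mapping.single 0 c"

definition Indet :: "'n \<Rightarrow> ('a::zero_neq_one, 'n) mvpoly" where
  "Indet i = Poly_Mapping.single (Poly_Mapping.single i 1) 1"

definition indets :: "('a::zero, 'n) mvpoly \<Rightarrow> 'n set" where
  "indets p = (\<Union>m\<in>Poly_Mapping.keys p. Poly_Mapping.keys m)"

definition eval_poly :: "('a::comm_semiring_1, 'n::finite) mvpoly \<Rightarrow> 'a ^ 'n \<Rightarrow> 'a" where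
  "eval_poly p x = (\<Sum>m\<in>Poly_Mapping.keys p.
     Poly_Mapping.lookup p m * (\<Prod>i\<in>UNIV. (x $ i) ^ Poly_Mapping.lookup m i))"

text \<open>The zero polynomial is not counted as a form.\<close>

definition is_form :: "nat \<Rightarrow> ('a::zero, 'n::finite) mvpoly \<Rightarrow> bool" where
  "is_form d p \<longleftrightarrow> p \<noteq> 0 \<and>
     (\<forall>m\<in>Poly_Mapping.keys p. (\<Sum>i\<in>UNIV. Poly_Mapping.lookup m i) = d)"

text \<open>The linear substitution \<open>x\<^sub>i \<mapsto> \<Sum>\<^sub>j A\<^sub>i\<^sub>j x\<^sub>j\<close>.\<close>

definition linear_subst :: "'a ^ 'n ^ 'n \<Rightarrow> ('a::comm_ring_1, 'n::finite) mvpoly \<Rightarrow> ('a, 'n) mvpoly"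
  where
  "linear_subst A p = (\<Sum>m\<in>Poly_Mapping.keys p.
     Const (Poly_Mapping.lookup p m) *
     (\<Prod>i\<in>UNIV. (\<Sum>j\<in>UNIV. Const (A $ i $ j) * Indet j) ^ Poly_Mapping.lookup m i))"

definition form_rank :: "('a::field, 'n::finite) mvpoly \<Rightarrow> nat" where
  "form_rank f = (LEAST r. \<exists>A :: 'a ^ 'n ^ 'n. invertible A \<and> card (indets (linear_subst A f)) = r)"

definition degenerate :: "('a::field, 'n::finite) mvpoly \<Rightarrow> bool" where
  "degenerate f \<longleftrightarrow> form_rank f < CARD('n)"

text \<open>
  The points of the projective space on \<open>K\<^sup>n\<close> are the one-dimensional subspaces of \<open>K\<^sup>n\<close>, so
  the index type \<open>5\<close> gives the projective space of dimension 4.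
\<close>

definition proj_points :: "(('a::field) ^ 'n::finite) set set" where
  "proj_points = {P. vec.subspace P \<and> vec.dim P = 1}"

definition zero_set :: "('a::field, 'n::finite) mvpoly \<Rightarrow> ('a ^ 'n) set set" where
  "zero_set f = {P \<in> proj_points. \<forall>x\<in>P. eval_poly f x = 0}"

text \<open>
  The projective dimension is one less than the vector space dimension; the empty linear subspace
  has dimension \<open>-1\<close>, so that the maximum is also taken over a nonempty set when \<open>X\<close> is empty.
\<close>

definition projective_index :: "('a::field ^ 'n::finite) set set \<Rightarrow> int" where
  "projective_index X = Max {int (vec.dim W) - 1 | W.
     vec.subspace W \<and> {P \<in> proj_points. P \<subseteq> W} \<subseteq> X}"

end

theory Submission
  imports Defs
begin

text \<open>
  A form of degree 2 is determined by the quadratic map \<open>Q\<close> it induces, even over the field with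
  two elements, and its rank is the codimension of the radical of \<open>Q\<close>. So \<open>X\<close> is a cone whose
  vertex is the radical. In rank 3 its base is empty or the conic \<open>x z + k y\<^sup>2 = 0\<close>, parametrized by
  the projective line; in rank 4 a totally singular subspace of dimension 3 gives two hyperbolic
  pairs, and the base is the Segre quadric \<open>x\<^sub>1 y\<^sub>1 + x\<^sub>2 y\<^sub>2 = 0\<close>, parametrized by a product of
  two lines. Over each point of the base one counts the zeros of \<open>f\<close> in the affine space of the
  generator minus the vertex.

  If the vertex is not contained in the radical of \<open>f\<close>, this gives at
  most \<open>3 q\<^sup>2 + q + 1\<close> points. Otherwise \<open>f\<close> is a cone with the same vertex, and one has to
  intersect the bases: two conics share at most 4 points (zeros of a binary quartic), and a curve of
  bidegree \<open>(2, 2)\<close> has \<open>4 q\<close> points (four lines) or at most \<open>3 q + 1\<close>.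
\<close>

subsection \<open>Quadratic forms as functions\<close>

text \<open>Two obstacles shape the proof. In characteristic 2 a quadratic form is not determined by
  its polar form and need not be diagonalisable, so the normal forms are built from hyperbolic
  pairs. And every estimate must hold down to q = 2: twice the bound is reached only through 2 q <=
  q^2, an equality there, and the nonvanishing arguments may use only three points of a projective
  line. Points are counted through vectors: the zeros of the first form split into the vertex and
  the nonzero multiples of one chosen vector per point off the vertex, and a common factor q - 1 is
  cancelled. The exceptional values are the cases with four planes or four lines in the base: in
  rank 3, four generator planes with q^2 points each off the vertex line, which adds q + 1; in rank
  4, 4 q generator lines with q points each off the vertex, which adds 1. The bound 3 q^2 + q + 1
  appears exactly in rank 4 in two ways: as (q + 1)^2 + (2 q + 1)(q - 1) + 1 when the vertex lies on
  the second quadric without being radical, and as (3 q + 1) q + 1 when it is radical.\<close>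

lemma eval_poly_superset:
  assumes "finite S" "Poly_Mapping.keys p \<subseteq> S"
  shows "eval_poly p x =
    (\<Sum>m\<in>S. Poly_Mapping.lookup p m * (\<Prod>i\<in>UNIV. (x $ i) ^ Poly_Mapping.lookup m i))"
  unfolding eval_poly_def using assms
  by (intro sum.mono_neutral_left) (auto simp: in_keys_iff)

lemma eval_poly_0 [simp]: "eval_poly 0 x = 0"
  by (simp add: eval_poly_def)

lemma eval_poly_single:
  "eval_poly (Poly_Mapping.single m c) x = c * (\<Prod>i\<in>UNIV. (x $ i) ^ Poly_Mapping.lookup m i)"
  by (simp add: eval_poly_def)

lemma eval_poly_add: "eval_poly (p + q) x = eval_poly p x + eval_poly q x"
proof -
  let ?S = "Poly_Mapping.keys p \<union> Poly_Mapping.keys q"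
  have "finite ?S" "Poly_Mapping.keys (p + q) \<subseteq> ?S"
    using keys_add[of p q] by auto
  then show ?thesis
    by (simp add: eval_poly_superset[of ?S] lookup_add distrib_right sum.distrib)
qed

lemma eval_poly_sum: "eval_poly (\<Sum>i\<in>I. g i) x = (\<Sum>i\<in>I. eval_poly (g i) x)"
  by (induction I rule: infinite_finite_induct) (auto simp: eval_poly_add)

lemma poly_mapping_eq_sum_single:
  "p = (\<Sum>m\<in>Poly_Mapping.keys p. Poly_Mapping.single m (Poly_Mapping.lookup p m))"
proof (rule poly_mapping_eqI)
  fix k
  have "(\<Sum>m\<in>Poly_Mapping.keys p. Poly_Mapping.lookup (Poly_Mapping.single m (Poly_Mapping.lookup p m)) k)
      = (\<Sum>m\<in>Poly_Mapping.keys p. if m = k then Poly_Mapping.lookup p m else 0)"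
    by (intro sum.cong) (auto simp: lookup_single when_def)
  also have "\<dots> = Poly_Mapping.lookup p k"
    by (auto simp: in_keys_iff)
  finally show "Poly_Mapping.lookup p k = Poly_Mapping.lookup
      (\<Sum>m\<in>Poly_Mapping.keys p. Poly_Mapping.single m (Poly_Mapping.lookup p m)) k"
    by (simp add: lookup_sum)
qed

lemma eval_poly_mult: "eval_poly (p * q) x = eval_poly p x * eval_poly q x"
proof -
  have "eval_poly (p * q) x = eval_poly
     ((\<Sum>m\<in>Poly_Mapping.keys p. Poly_Mapping.single m (Poly_Mapping.lookup p m)) *
      (\<Sum>m\<in>Poly_Mapping.keys q. Poly_Mapping.single m (Poly_Mapping.lookup q m))) x"
    using poly_mapping_eq_sum_single[of p] poly_mapping_eq_sum_single[of q] by simp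
  also have "\<dots> = eval_poly p x * eval_poly q x"
    unfolding sum_product eval_poly_sum mult_single eval_poly_single
    by (simp add: eval_poly_def sum_product lookup_add power_add prod.distrib mult_ac)
  finally show ?thesis .
qed

lemma eval_poly_Const [simp]: "eval_poly (Const c) x = c"
  by (simp add: Const_def eval_poly_single)

lemma eval_poly_1 [simp]: "eval_poly 1 x = 1"
  using eval_poly_Const[of 1 x] by (simp add: Const_def)

lemma eval_poly_power: "eval_poly (p ^ n) x = eval_poly p x ^ n"
  by (induction n) (auto simp: eval_poly_mult)

lemma eval_poly_prod: "eval_poly (\<Prod>i\<in>I. g i) x = (\<Prod>i\<in>I. eval_poly (g i) x)"
  by (induction I rule: infinite_finite_induct) (auto simp: eval_poly_mult)

lemma eval_poly_Indet [simp]: "eval_poly (Indet i) x = x $ i"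
proof -
  have "(\<Prod>j\<in>UNIV. (x $ j) ^ Poly_Mapping.lookup (Poly_Mapping.single i 1) j) =
        (\<Prod>j\<in>UNIV. if j = i then x $ j else 1)"
    by (intro prod.cong) (auto simp: lookup_single when_def)
  then show ?thesis
    by (simp add: Indet_def eval_poly_single)
qed

lemma eval_poly_linear_subst: "eval_poly (linear_subst A p) x = eval_poly p (A *v x)"
  by (simp add: linear_subst_def eval_poly_sum eval_poly_mult eval_poly_prod eval_poly_power
      matrix_vector_mult_def eval_poly_def[of p])

text \<open>Unlike \<open>is_form\<close> this admits the zero polynomial, so it is closed under
  sums and differences; the difference \<open>f - Const c * g\<close> has to qualify before it is
  shown to vanish.\<close>

definition homogeneous :: "nat \<Rightarrow> ('a::zero, 'n::finite) mvpoly \<Rightarrow> bool" where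
  "homogeneous d p \<longleftrightarrow> (\<forall>m\<in>Poly_Mapping.keys p. (\<Sum>i\<in>UNIV. Poly_Mapping.lookup m i) = d)"

lemma homogeneous_0 [simp]: "homogeneous d 0"
  by (simp add: homogeneous_def)

lemma homogeneous_add: "homogeneous d p \<Longrightarrow> homogeneous d q \<Longrightarrow> homogeneous d (p + q)"
  using keys_add[of p q] unfolding homogeneous_def by blast

lemma homogeneous_diff:
  fixes p q :: "('a::ab_group_add, 'n::finite) mvpoly"
  shows "homogeneous d p \<Longrightarrow> homogeneous d q \<Longrightarrow> homogeneous d (p - q)"
  using keys_diff[of p q] unfolding homogeneous_def by blast

lemma homogeneous_sum: "(\<And>i. i \<in> I \<Longrightarrow> homogeneous d (g i)) \<Longrightarrow> homogeneous d (\<Sum>i\<in>I. g i)"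
  by (induction I rule: infinite_finite_induct) (auto simp: homogeneous_add)

lemma homogeneous_mult:
  assumes "homogeneous d p" "homogeneous e q"
  shows "homogeneous (d + e) (p * q)"
  unfolding homogeneous_def
proof
  fix m assume "m \<in> Poly_Mapping.keys (p * q)"
  then obtain a b where "m = a + b" "a \<in> Poly_Mapping.keys p" "b \<in> Poly_Mapping.keys q"
    using keys_mult[of p q] by blast
  then show "(\<Sum>i\<in>UNIV. Poly_Mapping.lookup m i) = d + e"
    using assms by (simp add: homogeneous_def lookup_add sum.distrib)
qed

lemma homogeneous_Const: "homogeneous 0 (Const c)"
  by (auto simp: homogeneous_def Const_def)

lemma homogeneous_1: "homogeneous 0 (1 :: ('a::comm_semiring_1, 'n::finite) mvpoly)"
  by (simp add: homogeneous_def)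

lemma homogeneous_Indet: "homogeneous 1 (Indet i)"
proof -
  have "(\<Sum>j\<in>UNIV. Poly_Mapping.lookup (Poly_Mapping.single i (1::nat)) j) =
        (\<Sum>j\<in>UNIV. if j = i then 1 else 0)"
    by (intro sum.cong) (auto simp: lookup_single when_def)
  then show ?thesis
    by (auto simp: homogeneous_def Indet_def)
qed

lemma homogeneous_power:
  fixes p :: "('a::comm_semiring_1, 'n::finite) mvpoly"
  shows "homogeneous d p \<Longrightarrow> homogeneous (n * d) (p ^ n)"
  by (induction n) (auto simp: homogeneous_1 intro: homogeneous_mult)

lemma homogeneous_prod:
  fixes g :: "'i \<Rightarrow> ('a::comm_semiring_1, 'n::finite) mvpoly"
  shows "(\<And>i. i \<in> I \<Longrightarrow> homogeneous (d i) (g i)) \<Longrightarrow> homogeneous (\<Sum>i\<in>I. d i) (\<Prod>i\<in>I. g i)"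
  by (induction I rule: infinite_finite_induct) (auto simp: homogeneous_1 intro!: homogeneous_mult)

lemma homogeneous_linear_subst:
  assumes "homogeneous d p"
  shows "homogeneous d (linear_subst A p)"
  unfolding linear_subst_def
proof (rule homogeneous_sum)
  fix m assume m: "m \<in> Poly_Mapping.keys p"
  have lin: "homogeneous 1 (\<Sum>j\<in>UNIV. Const (A $ i $ j) * Indet j)" for i
    using homogeneous_mult[OF homogeneous_Const homogeneous_Indet]
    by (intro homogeneous_sum) simp
  have "homogeneous (0 + (\<Sum>i\<in>UNIV. Poly_Mapping.lookup m i * 1)) (Const (Poly_Mapping.lookup p m) *
     (\<Prod>i\<in>UNIV. (\<Sum>j\<in>UNIV. Const (A $ i $ j) * Indet j) ^ Poly_Mapping.lookup m i))"
    by (intro homogeneous_mult homogeneous_Const homogeneous_prod homogeneous_power lin)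
  then show "homogeneous d (Const (Poly_Mapping.lookup p m) *
     (\<Prod>i\<in>UNIV. (\<Sum>j\<in>UNIV. Const (A $ i $ j) * Indet j) ^ Poly_Mapping.lookup m i))"
    using assms m by (simp add: homogeneous_def)
qed

lemma degree_2_monomial:
  fixes m :: "'n::finite \<Rightarrow>\<^sub>0 nat"
  assumes "(\<Sum>i\<in>UNIV. Poly_Mapping.lookup m i) = 2"
  obtains i j where "m = Poly_Mapping.single i 1 + Poly_Mapping.single j 1"
proof -
  obtain i where i: "Poly_Mapping.lookup m i \<noteq> 0"
    using assms by (metis sum.neutral zero_neq_numeral)
  define m' where "m' = m - Poly_Mapping.single i 1"
  have m: "m = Poly_Mapping.single i 1 + m'"
    using i by (intro poly_mapping_eqI) (auto simp: m'_def lookup_add lookup_minus lookup_single when_def)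
  have s: "(\<Sum>k\<in>UNIV. Poly_Mapping.lookup (Poly_Mapping.single i (1::nat)) k) = 1" for i :: 'n
    using homogeneous_Indet[of i] by (simp add: homogeneous_def Indet_def)
  have 1: "(\<Sum>k\<in>UNIV. Poly_Mapping.lookup m' k) = 1"
    using assms s[of i] unfolding m lookup_add sum.distrib by simp
  then obtain j where j: "Poly_Mapping.lookup m' j \<noteq> 0"
    by (metis sum.neutral zero_neq_one)
  define m'' where "m'' = m' - Poly_Mapping.single j 1"
  have m': "m' = Poly_Mapping.single j 1 + m''"
    using j by (intro poly_mapping_eqI) (auto simp: m''_def lookup_add lookup_minus lookup_single when_def)
  have "(\<Sum>k\<in>UNIV. Poly_Mapping.lookup m'' k) = 0"
    using 1 s[of j] unfolding m' lookup_add sum.distrib by simp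
  then have "m'' = 0"
    by (intro poly_mapping_eqI) simp
  with m m' show ?thesis
    using that by simp
qed

lemma monomial_eval_degree_2:
  fixes x :: "'a::comm_semiring_1 ^ 'n::finite"
  shows "(\<Prod>k\<in>UNIV. (x $ k) ^ Poly_Mapping.lookup (Poly_Mapping.single i 1 + Poly_Mapping.single j 1) k)
    = x $ i * x $ j"
proof -
  have "(\<Prod>k\<in>UNIV. (x $ k) ^ Poly_Mapping.lookup (Poly_Mapping.single i 1) k) = x $ i" for i :: 'n
    using eval_poly_Indet[of i x] by (simp add: Indet_def eval_poly_single)
  then show ?thesis
    by (simp add: lookup_add power_add prod.distrib)
qed

section \<open>Quadratic maps in arbitrary characteristic\<close>

definition polar :: "('b::ab_group_add \<Rightarrow> 'a::ab_group_add) \<Rightarrow> 'b \<Rightarrow> 'b \<Rightarrow> 'a" where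
  "polar Q x y = Q (x + y) - Q x - Q y"

definition quadratic_map :: "('a::field ^ 'n \<Rightarrow> 'a) \<Rightarrow> bool" where
  "quadratic_map Q \<longleftrightarrow> (\<forall>c x. Q (c *s x) = c^2 * Q x) \<and>
     (\<forall>x y z. polar Q (x + y) z = polar Q x z + polar Q y z) \<and>
     (\<forall>c x y. polar Q (c *s x) y = c * polar Q x y)"

text \<open>Translation invariance combines the two conditions of \<open>radical_iff\<close>:
  singular, and orthogonal to everything. In characteristic 2 the second does not imply the first:
  \<open>y^2\<close> has polar form 0.\<close>

definition radical :: "('b::ab_group_add \<Rightarrow> 'a) \<Rightarrow> 'b set" where
  "radical Q = {v. \<forall>x. Q (x + v) = Q x}"

lemma quadratic_map_monomial: "quadratic_map (\<lambda>x. c * (x $ i * x $ j))"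
  unfolding quadratic_map_def polar_def by (auto simp: algebra_simps power2_eq_square)

lemma quadratic_map_sum:
  "(\<And>i. i \<in> I \<Longrightarrow> quadratic_map (g i)) \<Longrightarrow> quadratic_map (\<lambda>x. \<Sum>i\<in>I. g i x)"
proof -
  assume *: "\<And>i. i \<in> I \<Longrightarrow> quadratic_map (g i)"
  have p: "polar (\<lambda>x. \<Sum>i\<in>I. g i x) x y = (\<Sum>i\<in>I. polar (g i) x y)" for x y
    by (simp add: polar_def sum_subtractf)
  show ?thesis
    unfolding quadratic_map_def p
  proof (intro conjI allI)
    fix c x y z
    show "(\<Sum>i\<in>I. g i (c *s x)) = c\<^sup>2 * (\<Sum>i\<in>I. g i x)"
      using * by (auto simp: quadratic_map_def sum_distrib_left intro!: sum.cong)
    show "(\<Sum>i\<in>I. polar (g i) (x + y) z) = (\<Sum>i\<in>I. polar (g i) x z) + (\<Sum>i\<in>I. polar (g i) y z)"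
      unfolding sum.distrib[symmetric] using * by (auto simp: quadratic_map_def intro!: sum.cong)
    show "(\<Sum>i\<in>I. polar (g i) (c *s x) y) = c * (\<Sum>i\<in>I. polar (g i) x y)"
      using * by (auto simp: quadratic_map_def sum_distrib_left intro!: sum.cong)
  qed
qed

lemma quadratic_map_eval_poly:
  assumes "homogeneous 2 p"
  shows "quadratic_map (eval_poly p)"
proof -
  have "quadratic_map (\<lambda>x. \<Sum>m\<in>Poly_Mapping.keys p. Poly_Mapping.lookup p m *
      (\<Prod>i\<in>UNIV. (x $ i) ^ Poly_Mapping.lookup m i))"
  proof (rule quadratic_map_sum)
    fix m assume "m \<in> Poly_Mapping.keys p"
    then obtain i j where "m = Poly_Mapping.single i 1 + Poly_Mapping.single j 1"
      using assms degree_2_monomial unfolding homogeneous_def by blast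
    then show "quadratic_map (\<lambda>x. Poly_Mapping.lookup p m *
        (\<Prod>i\<in>UNIV. (x $ i) ^ Poly_Mapping.lookup m i))"
      using quadratic_map_monomial[of "Poly_Mapping.lookup p m" i j]
      by (simp only: monomial_eval_degree_2)
  qed
  then show ?thesis
    by (simp add: eval_poly_def[abs_def])
qed

section \<open>Recovering the coefficients from the values\<close>

lemma single_add_single_eq_iff:
  "Poly_Mapping.single i (1::nat) + Poly_Mapping.single j 1 =
   Poly_Mapping.single k 1 + Poly_Mapping.single l 1 \<longleftrightarrow> i = k \<and> j = l \<or> i = l \<and> j = k"
proof
  assume *: "Poly_Mapping.single i (1::nat) + Poly_Mapping.single j 1 =
   Poly_Mapping.single k 1 + Poly_Mapping.single l 1"
  have eq: "(if i = a then 1 else 0) + (if j = a then 1 else 0 :: nat) =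
        (if k = a then 1 else 0) + (if l = a then 1 else 0)" for a
    using arg_cong[OF *, of "\<lambda>m. Poly_Mapping.lookup m a"]
    by (simp only: lookup_add lookup_single when_def)
  show "i = k \<and> j = l \<or> i = l \<and> j = k"
  proof (cases "i = k")
    case True
    then show ?thesis
      using eq[of j] by (auto split: if_splits)
  next
    case False
    then have "i = l"
      using eq[of i] by (auto split: if_splits)
    then show ?thesis
      using eq[of j] by (auto split: if_splits)
  qed
qed (auto simp: add.commute)

lemma eval_poly_axis:
  assumes "homogeneous 2 p"
  shows "eval_poly p (axis i 1) = Poly_Mapping.lookup p (Poly_Mapping.single i 1 + Poly_Mapping.single i 1)"
    (is "_ = Poly_Mapping.lookup p ?m")
proof -
  have "eval_poly p (axis i 1) = (\<Sum>m\<in>Poly_Mapping.keys p.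
      if m = ?m then Poly_Mapping.lookup p m else 0)"
    unfolding eval_poly_def
  proof (rule sum.cong[OF refl])
    fix m assume "m \<in> Poly_Mapping.keys p"
    then obtain k l where m: "m = Poly_Mapping.single k 1 + Poly_Mapping.single l 1"
      using assms degree_2_monomial unfolding homogeneous_def by blast
    show "Poly_Mapping.lookup p m * (\<Prod>j\<in>UNIV. (axis i 1 $ j) ^ Poly_Mapping.lookup m j) =
        (if m = ?m then Poly_Mapping.lookup p m else 0)"
      unfolding m monomial_eval_degree_2 single_add_single_eq_iff by (auto simp: axis_def)
  qed
  also have "\<dots> = Poly_Mapping.lookup p ?m"
    by (auto simp: in_keys_iff)
  finally show ?thesis .
qed

lemma polar_eval_poly_axis:
  assumes "homogeneous 2 p" "i \<noteq> j"
  shows "polar (eval_poly p) (axis i 1) (axis j 1) =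
    Poly_Mapping.lookup p (Poly_Mapping.single i 1 + Poly_Mapping.single j 1)"
    (is "_ = Poly_Mapping.lookup p ?m")
proof -
  have "polar (eval_poly p) (axis i 1) (axis j 1) = (\<Sum>m\<in>Poly_Mapping.keys p.
      if m = ?m then Poly_Mapping.lookup p m else 0)"
    unfolding eval_poly_def polar_def sum_subtractf[symmetric]
  proof (rule sum.cong[OF refl])
    fix m assume "m \<in> Poly_Mapping.keys p"
    then obtain k l where m: "m = Poly_Mapping.single k 1 + Poly_Mapping.single l 1"
      using assms degree_2_monomial unfolding homogeneous_def by blast
    show "Poly_Mapping.lookup p m * (\<Prod>k\<in>UNIV. ((axis i 1 + axis j 1) $ k) ^ Poly_Mapping.lookup m k) -
        Poly_Mapping.lookup p m * (\<Prod>k\<in>UNIV. (axis i 1 $ k) ^ Poly_Mapping.lookup m k) -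
        Poly_Mapping.lookup p m * (\<Prod>k\<in>UNIV. (axis j 1 $ k) ^ Poly_Mapping.lookup m k) =
        (if m = ?m then Poly_Mapping.lookup p m else 0)"
      unfolding m monomial_eval_degree_2 single_add_single_eq_iff using assms(2)
      by (auto simp: axis_def)
  qed
  also have "\<dots> = Poly_Mapping.lookup p ?m"
    by (auto simp: in_keys_iff)
  finally show ?thesis .
qed

lemma homogeneous_2_coeffs:
  assumes "homogeneous 2 p"
    and "\<And>i j. Poly_Mapping.lookup p (Poly_Mapping.single i 1 + Poly_Mapping.single j 1) = 0"
  shows "p = 0"
proof (rule poly_mapping_eqI)
  fix m
  show "Poly_Mapping.lookup p m = Poly_Mapping.lookup 0 m"
  proof (cases "m \<in> Poly_Mapping.keys p")
    case True
    then obtain i j where "m = Poly_Mapping.single i 1 + Poly_Mapping.single j 1"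
      using assms(1) degree_2_monomial unfolding homogeneous_def by blast
    with assms(2) show ?thesis by simp
  qed (simp add: in_keys_iff)
qed

text \<open>Each coefficient is a value of \<open>Q\<close> at a unit vector or of its polar form at
  two of them, so no assumption on the size of the field enters. In degree 3 this breaks down:
  \<open>x^2 y + x y^2\<close> induces the zero function over the field with two elements.\<close>

lemma eval_poly_eq_0_imp:
  fixes p :: "('a::field, 'n::finite) mvpoly"
  assumes "homogeneous 2 p" "\<And>x. eval_poly p x = 0"
  shows "p = 0"
proof (rule homogeneous_2_coeffs[OF assms(1)])
  fix i j
  show "Poly_Mapping.lookup p (Poly_Mapping.single i 1 + Poly_Mapping.single j 1) = 0"
    using eval_poly_axis[OF assms(1), of i] polar_eval_poly_axis[OF assms(1), of i j] assms(2)
    by (cases "i = j") (auto simp: polar_def)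
qed

text \<open>For a radical unit vector, \<open>Q\<close> vanishes there, which is the coefficient of
  the square, and so do the polar products with the other unit vectors, which are the coefficients
  of the mixed monomials.\<close>

lemma not_in_indets_iff:
  fixes p :: "('a::field, 'n::finite) mvpoly"
  assumes hom: "homogeneous 2 p"
  shows "i \<notin> indets p \<longleftrightarrow> axis i 1 \<in> radical (eval_poly p)"
proof
  assume i: "i \<notin> indets p"
  have "eval_poly p (x + axis i 1) = eval_poly p x" for x
    unfolding eval_poly_def
  proof (intro sum.cong refl arg_cong2[where f = "(*)"] prod.cong)
    fix m k assume "m \<in> Poly_Mapping.keys p"
    then have "Poly_Mapping.lookup m i = 0"
      using i by (auto simp: indets_def in_keys_iff)
    then show "((x + axis i 1) $ k) ^ Poly_Mapping.lookup m k = x $ k ^ Poly_Mapping.lookup m k"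
      by (cases "k = i") (auto simp: axis_def)
  qed
  then show "axis i 1 \<in> radical (eval_poly p)"
    by (simp add: radical_def)
next
  assume r: "axis i 1 \<in> radical (eval_poly p)"
  have q0: "eval_poly p 0 = 0"
    using quadratic_map_eval_poly[OF hom] unfolding quadratic_map_def
    by (metis vector_smult_lzero mult_zero_left power2_eq_square)
  have q1: "eval_poly p (axis i 1) = 0"
    using r q0 by (metis (mono_tags, lifting) add_0 mem_Collect_eq radical_def)
  have q2: "polar (eval_poly p) (axis j 1) (axis i 1) = 0" for j
    using r q1 by (simp add: polar_def radical_def)
  show "i \<notin> indets p"
  proof
    assume "i \<in> indets p"
    then obtain m where m: "m \<in> Poly_Mapping.keys p" "Poly_Mapping.lookup m i \<noteq> 0"
      by (auto simp: indets_def in_keys_iff)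
    then obtain k l where kl: "m = Poly_Mapping.single k 1 + Poly_Mapping.single l 1"
      using hom degree_2_monomial unfolding homogeneous_def by blast
    then have "i = k \<or> i = l"
      using m(2) by (auto simp: lookup_add lookup_single when_def split: if_splits)
    then obtain j where "m = Poly_Mapping.single j 1 + Poly_Mapping.single i 1"
      using kl by (auto simp: add.commute)
    then have "Poly_Mapping.lookup p m = 0"
      using q1 q2[of j] eval_poly_axis[OF hom, of i] polar_eval_poly_axis[OF hom, of j i]
      by (cases "i = j") auto
    with m(1) show False
      by (simp add: in_keys_iff)
  qed
qed

subsection \<open>Radical, rank and projective points\<close>

lemma quadratic_map_scale: "quadratic_map Q \<Longrightarrow> Q (c *s x) = c\<^sup>2 * Q x"
  by (simp add: quadratic_map_def)

lemma quadratic_map_zero: "quadratic_map Q \<Longrightarrow> Q 0 = 0"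
  using quadratic_map_scale[of Q 0 0] by simp

lemma quadratic_map_add: "quadratic_map Q \<Longrightarrow> Q (x + y) = Q x + Q y + polar Q x y"
  by (simp add: polar_def)

lemma polar_commute: "polar Q x y = polar Q y x"
  by (simp add: polar_def add.commute)

lemma polar_add_left: "quadratic_map Q \<Longrightarrow> polar Q (x + y) z = polar Q x z + polar Q y z"
  by (simp add: quadratic_map_def)

lemma polar_add_right: "quadratic_map Q \<Longrightarrow> polar Q z (x + y) = polar Q z x + polar Q z y"
  using polar_add_left polar_commute by metis

lemma polar_scale_left: "quadratic_map Q \<Longrightarrow> polar Q (c *s x) y = c * polar Q x y"
  by (simp add: quadratic_map_def)

lemma polar_scale_right: "quadratic_map Q \<Longrightarrow> polar Q y (c *s x) = c * polar Q y x"
  using polar_scale_left polar_commute by metis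

lemma polar_self: "quadratic_map Q \<Longrightarrow> polar Q x x = 2 * Q x"
proof -
  assume *: "quadratic_map Q"
  have "x + x = 2 *s x"
    by (simp add: vec_eq_iff)
  then have "polar Q x x = 2\<^sup>2 * Q x - Q x - Q x"
    unfolding polar_def using quadratic_map_scale[OF *, of 2 x] by simp
  also have "\<dots> = 2 * Q x"
    by (simp add: algebra_simps)
  finally show ?thesis .
qed

lemma polar_zero_left: "quadratic_map Q \<Longrightarrow> polar Q 0 y = 0"
  using polar_scale_left[of Q 0 0 y] by simp

lemma polar_zero_right: "quadratic_map Q \<Longrightarrow> polar Q y 0 = 0"
  using polar_zero_left polar_commute by metis

lemma quadratic_map_minus: "quadratic_map Q \<Longrightarrow> Q (- x) = Q x"
  using quadratic_map_scale[of Q "-1" x] by simp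

lemma polar_minus_left: "quadratic_map Q \<Longrightarrow> polar Q (- x) y = - polar Q x y"
  using polar_scale_left[of Q "-1" x y] by simp

lemma polar_minus_right: "quadratic_map Q \<Longrightarrow> polar Q y (- x) = - polar Q y x"
  using polar_minus_left polar_commute by metis

lemma quadratic_map_diff: "quadratic_map Q \<Longrightarrow> Q (x - y) = Q x + Q y - polar Q x y"
  using quadratic_map_add[of Q x "- y"] by (simp add: quadratic_map_minus polar_minus_right)

lemma polar_diff_left: "quadratic_map Q \<Longrightarrow> polar Q (x - y) z = polar Q x z - polar Q y z"
  using polar_add_left[of Q x "- y" z] by (simp add: polar_minus_left)

lemma polar_diff_right: "quadratic_map Q \<Longrightarrow> polar Q z (x - y) = polar Q z x - polar Q z y"
  using polar_diff_left polar_commute by metis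

lemmas quadratic_map_simps = quadratic_map_zero polar_zero_left polar_zero_right
  quadratic_map_scale polar_scale_left polar_scale_right
  quadratic_map_minus polar_minus_left polar_minus_right
  quadratic_map_add polar_add_left polar_add_right
  quadratic_map_diff polar_diff_left polar_diff_right

lemma radical_iff:
  assumes "quadratic_map Q"
  shows "v \<in> radical Q \<longleftrightarrow> Q v = 0 \<and> (\<forall>x. polar Q x v = 0)"
proof
  assume v: "v \<in> radical Q"
  then have "Q (0 + v) = Q 0"
    unfolding radical_def by blast
  then have "Q v = 0"
    using quadratic_map_zero[OF assms] by simp
  with v show "Q v = 0 \<and> (\<forall>x. polar Q x v = 0)"
    by (simp add: radical_def polar_def)
qed (simp add: radical_def quadratic_map_add[OF assms])

lemma subspace_radical:
  assumes "quadratic_map Q"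
  shows "vec.subspace (radical Q)"
  using assms by (auto intro!: vec.subspaceI simp: radical_iff[OF assms] quadratic_map_simps[OF assms])

text \<open>The substitution \<open>A\<close> removes the indeterminate \<open>i\<close> exactly
  when column \<open>i\<close> of \<open>A\<close> is radical. The columns form a basis, so at most
  \<open>vec.dim\<close> of the radical many can be removed, and a basis of the radical extended to
  the whole space removes that many.\<close>

lemma form_rank_plus_dim_radical:
  fixes f :: "('a::field, 'n::finite) mvpoly"
  assumes hom: "homogeneous 2 f"
  shows "form_rank f + vec.dim (radical (eval_poly f)) = CARD('n)"
proof (rule antisym)
  let ?P = "\<lambda>r. \<exists>A :: 'a ^ 'n ^ 'n. invertible A \<and> card (indets (linear_subst A f)) = r"
  let ?R = "radical (eval_poly f)"
  have column_iff: "i \<notin> indets (linear_subst A f) \<longleftrightarrow> A *v axis i 1 \<in> ?R" if "invertible A" for A i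
  proof -
    have "surj ((*v) A)"
      using that by (metis invertible_right_inverse matrix_right_invertible_surjective)
    then have "(\<forall>x. eval_poly f (A *v x + A *v axis i 1) = eval_poly f (A *v x)) \<longleftrightarrow>
      (\<forall>y. eval_poly f (y + A *v axis i 1) = eval_poly f y)"
      unfolding surj_def by metis
    then show ?thesis
      unfolding not_in_indets_iff[OF homogeneous_linear_subst[OF hom]]
      by (simp add: radical_def eval_poly_linear_subst matrix_vector_right_distrib)
  qed
  have "?P (form_rank f)"
    unfolding form_rank_def by (rule LeastI_ex) (auto simp: invertible_def intro!: exI[of _ "mat 1"])
  then obtain A :: "'a ^ 'n ^ 'n" where A: "invertible A"
    and r: "card (indets (linear_subst A f)) = form_rank f"
    by blast
  let ?I = "- indets (linear_subst A f)"
  have inj: "inj ((*v) A)"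
    using A by (metis invertible_left_inverse matrix_left_invertible_injective)
  have inj_axis: "inj (\<lambda>i. axis i (1::'a) :: 'a ^ 'n)"
    by (auto simp: inj_on_def axis_eq_axis)
  let ?S = "(\<lambda>i. A *v axis i 1) ` ?I"
  have "vec.independent ((*v) A ` ((\<lambda>i. axis i 1) ` ?I))"
  proof (rule vec.linear_independent_injective_image)
    have "(\<lambda>i. axis i 1) ` ?I \<subseteq> (cart_basis :: ('a ^ 'n) set)"
      by (auto simp: cart_basis_def)
    then show "vec.independent ((\<lambda>i. axis i (1::'a)) ` ?I)"
      using independent_cart_basis vec.independent_mono by blast
    show "inj_on ((*v) A) (vec.span ((\<lambda>i. axis i 1) ` ?I))"
      using inj inj_on_subset by blast
  qed simp
  then have "vec.independent ?S"
    by (simp add: image_image)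
  moreover have "?S \<subseteq> ?R"
    using column_iff[OF A] by blast
  ultimately have "card ?S \<le> vec.dim ?R"
    by (rule vec.independent_card_le_dim[rotated])
  moreover have "inj_on (\<lambda>i. A *v axis i 1) ?I"
    using inj inj_axis by (auto simp: inj_on_def)
  ultimately have "card ?I \<le> vec.dim ?R"
    by (simp add: card_image)
  moreover have "card ?I = CARD('n) - card (indets (linear_subst A f))"
    by (simp add: Compl_eq_Diff_UNIV card_Diff_subset)
  ultimately show "CARD('n) \<le> form_rank f + vec.dim ?R"
    using r by linarith
next
  let ?R = "radical (eval_poly f)"
  obtain B where B: "B \<subseteq> ?R" "vec.independent B" "?R \<subseteq> vec.span B" "card B = vec.dim ?R"
    by (rule vec.basis_exists)
  obtain C where C: "B \<subseteq> C" "vec.independent C" "vec.span C = UNIV"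
    using vec.maximal_independent_subset_extend[OF subset_UNIV B(2)] top.extremum_uniqueI by metis
  have "finite C"
    using C(2) vec.finiteI_independent by blast
  moreover have "card C = CARD('n)"
    using C vec.dim_eq_card[of C UNIV] by (simp add: vec.dim_UNIV card_cart_basis)
  ultimately obtain \<phi> where \<phi>: "bij_betw \<phi> (UNIV :: 'n set) C"
    using finite_same_card_bij[of "UNIV :: 'n set" C] by auto
  define A :: "'a ^ 'n ^ 'n" where "A = (\<chi> i j. \<phi> j $ i)"
  have col: "A *v axis j 1 = \<phi> j" for j
    by (simp add: A_def matrix_vector_mult_def vec_eq_iff axis_def if_distrib cong: if_cong)
  have "columns A = C"
    using \<phi> col unfolding columns_def bij_betw_def
    by (auto simp: A_def column_def)
  then have inv: "invertible A"
    using C(3) matrix_right_invertible_span_columns invertible_right_inverse by metis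
  have "surj ((*v) A)"
    using inv by (metis invertible_right_inverse matrix_right_invertible_surjective)
  then have *: "(\<forall>x. eval_poly f (A *v x + A *v axis i 1) = eval_poly f (A *v x)) \<longleftrightarrow>
      (\<forall>y. eval_poly f (y + A *v axis i 1) = eval_poly f y)" for i
    unfolding surj_def by metis
  have "i \<notin> indets (linear_subst A f)" if "\<phi> i \<in> B" for i
    unfolding not_in_indets_iff[OF homogeneous_linear_subst[OF hom]]
    using that B(1) * [of i]
    by (auto simp: radical_def eval_poly_linear_subst matrix_vector_right_distrib col)
  then have "indets (linear_subst A f) \<subseteq> {i. \<phi> i \<in> C - B}"
    using \<phi> by (auto simp: bij_betw_def)
  then have "card (indets (linear_subst A f)) \<le> card {i. \<phi> i \<in> C - B}"
    by (intro card_mono) auto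
  also have "\<dots> = card (\<phi> ` {i. \<phi> i \<in> C - B})"
    using \<phi> by (intro card_image[symmetric]) (auto simp: bij_betw_def inj_on_def)
  also have "\<phi> ` {i. \<phi> i \<in> C - B} = C - B"
    using \<phi> by (auto simp: bij_betw_def)
  also have "card (C - B) = CARD('n) - vec.dim ?R"
    using \<open>finite C\<close> \<open>card C = CARD('n)\<close> C(1) B(4)
    by (metis card_Diff_subset finite_subset)
  finally have "card (indets (linear_subst A f)) \<le> CARD('n) - vec.dim ?R" .
  moreover have "form_rank f \<le> card (indets (linear_subst A f))"
    unfolding form_rank_def by (rule Least_le) (use inv in blast)
  moreover have "vec.dim ?R \<le> CARD('n)"
    using \<open>card C = CARD('n)\<close> \<open>finite C\<close> C(1) B(4) by (metis card_mono)
  ultimately show "form_rank f + vec.dim ?R \<le> CARD('n)"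
    by linarith
qed

section \<open>Projective points as punctured lines\<close>

lemma card_range_scale:
  fixes v :: "'a::{field, finite} ^ 'n::finite"
  assumes "v \<noteq> 0"
  shows "card (range (\<lambda>c. c *s v)) = CARD('a)"
  using assms by (intro card_image) (auto simp: inj_on_def)

lemma proj_points_eq: "proj_points = {range (\<lambda>c. c *s v) | v :: 'a::field ^ 'n::finite. v \<noteq> 0}"
proof (intro set_eqI iffI)
  fix P :: "('a ^ 'n) set"
  assume "P \<in> proj_points"
  then have P: "vec.subspace P" "vec.dim P = 1"
    by (auto simp: proj_points_def)
  obtain B where B: "B \<subseteq> P" "vec.independent B" "P \<subseteq> vec.span B" "card B = vec.dim P"
    by (rule vec.basis_exists)
  then obtain v where v: "B = {v}"
    using P(2) card_1_singletonE by metis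
  have "P = vec.span {v}"
    using B(1,3) P(1) v by (metis subset_antisym vec.span_minimal)
  moreover have "v \<noteq> 0"
    using B(2) v by simp
  ultimately show "P \<in> {range (\<lambda>c. c *s v) | v. v \<noteq> 0}"
    by (auto simp: vec.span_singleton)
next
  fix P :: "('a ^ 'n) set"
  assume "P \<in> {range (\<lambda>c. c *s v) | v. v \<noteq> 0}"
  then obtain v where "v \<noteq> 0" "P = vec.span {v}"
    by (auto simp: vec.span_singleton)
  then show "P \<in> proj_points"
    using vec.dim_eq_card[of "{v}" P] by (simp add: proj_points_def)
qed

text \<open>The nonzero vectors of \<open>S\<close> are partitioned into punctured lines of
  \<open>q - 1\<close> elements; all later counts of vectors carry this factor.\<close>

lemma card_proj_points_subset:
  fixes S :: "('a::{field, finite} ^ 'n::finite) set"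
  assumes zero: "0 \<in> S" and scale: "\<And>c x. x \<in> S \<Longrightarrow> c *s x \<in> S"
  shows "(CARD('a) - 1) * card {P \<in> proj_points. P \<subseteq> S} = card (S - {0})"
proof -
  let ?PP = "{P \<in> proj_points. P \<subseteq> S}"
  have "S - {0} = (\<Union>P\<in>?PP. P - {0})"
  proof (intro set_eqI iffI)
    fix x assume x: "x \<in> S - {0}"
    then have "range (\<lambda>c. c *s x) \<in> ?PP"
      using scale by (auto simp: proj_points_eq)
    moreover have "x \<in> range (\<lambda>c. c *s x)"
      by (rule range_eqI[of _ _ 1]) simp
    ultimately show "x \<in> (\<Union>P\<in>?PP. P - {0})"
      using x by blast
  qed auto
  moreover have "card (\<Union>P\<in>?PP. P - {0}) = (\<Sum>P\<in>?PP. card (P - {0}))"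
  proof (rule card_UN_disjoint; (intro ballI impI)?)
    fix P P' :: "('a ^ 'n) set" assume P: "P \<in> ?PP" "P' \<in> ?PP" "P \<noteq> P'"
    have "P = range (\<lambda>c. c *s x)" if x: "P \<in> proj_points" "x \<in> P" "x \<noteq> 0" for P and x :: "'a ^ 'n"
    proof -
      obtain v c where v: "P = range (\<lambda>c. c *s v)" "x = c *s v"
        using x unfolding proj_points_eq by blast
      then have "c \<noteq> 0"
        using x by auto
      then have *: "a *s v = (a * inverse c) *s x" "a *s x = (a * c) *s v" for a
        using v(2) by simp_all
      show ?thesis
        unfolding v(1)
      proof (intro antisym image_subsetI)
        show "a *s v \<in> range (\<lambda>c. c *s x)" for a
          by (rule range_eqI[of _ _ "a * inverse c"]) (rule *(1))
        show "a *s x \<in> range (\<lambda>c. c *s v)" for a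
          by (rule range_eqI[of _ _ "a * c"]) (rule *(2))
      qed
    qed
    note eq_range = this
    show "(P - {0}) \<inter> (P' - {0}) = {}"
    proof (rule ccontr)
      assume "(P - {0}) \<inter> (P' - {0}) \<noteq> {}"
      then obtain x where x: "x \<in> P" "x \<in> P'" "x \<noteq> 0"
        by blast
      have "P = range (\<lambda>c. c *s x)"
        by (rule eq_range) (use P(1) x in simp_all)
      moreover have "P' = range (\<lambda>c. c *s x)"
        by (rule eq_range) (use P(2) x in simp_all)
      ultimately show False
        using P(3) by simp
    qed
  qed auto
  moreover have "card (P - {0}) = CARD('a) - 1" if P: "P \<in> ?PP" for P
  proof -
    obtain v where v: "P = range (\<lambda>c. c *s v)" "v \<noteq> 0"
      using P by (auto simp: proj_points_eq)
    have "0 \<in> P"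
      unfolding v by (rule range_eqI[of _ _ 0]) simp
    then show ?thesis
      using card_range_scale[OF v(2)] v(1) by (simp add: card_Diff_singleton)
  qed
  ultimately show ?thesis
    by (simp add: mult.commute)
qed

text \<open>The maximum is attained, being taken over a finite set that contains -1 through the zero
  subspace. Here \<open>d\<close> is the vector space dimension, one more than the projective
  one.\<close>

lemma singular_subspace_of_projective_index:
  fixes f :: "('a::{field, finite}, 'n::finite) mvpoly"
  assumes "projective_index (zero_set f) = int d - 1" "eval_poly f 0 = 0"
  obtains W where "vec.subspace W" "vec.dim W = d" "\<And>x. x \<in> W \<Longrightarrow> eval_poly f x = 0"
proof -
  let ?M = "{int (vec.dim W) - 1 | W. vec.subspace W \<and> {P \<in> proj_points. P \<subseteq> W} \<subseteq> zero_set f}"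
  have "finite ?M"
    by (rule finite_subset[of _ "range (\<lambda>W :: ('a ^ 'n) set. int (vec.dim W) - 1)"]) auto
  moreover have "int (vec.dim ({0} :: ('a ^ 'n) set)) - 1 \<in> ?M"
  proof -
    have "{P \<in> proj_points. P \<subseteq> {0 :: 'a ^ 'n}} = {}"
      by (auto simp: proj_points_eq image_subset_iff vec_eq_iff)
    then show ?thesis
      using vec.subspace_single_0 by blast
  qed
  ultimately have "Max ?M \<in> ?M"
    by (intro Max_in) auto
  then obtain W where W: "vec.subspace W" "int (vec.dim W) = int d"
      "{P \<in> proj_points. P \<subseteq> W} \<subseteq> zero_set f"
    using assms(1) unfolding projective_index_def by auto
  have "eval_poly f x = 0" if "x \<in> W" for x
  proof (cases "x = 0")
    case False
    have "range (\<lambda>c. c *s x) \<in> {P \<in> proj_points. P \<subseteq> W}"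
      using False that W(1) by (auto simp: proj_points_eq vec.subspace_scale)
    then have "range (\<lambda>c. c *s x) \<in> zero_set f"
      using W(3) by blast
    then have "eval_poly f (1 *s x) = 0"
      unfolding zero_set_def by blast
    then show ?thesis by simp
  qed (use assms in simp)
  with W that show ?thesis by simp
qed

subsection \<open>Counting zeros on lines, planes and products of lines\<close>

lemma card_pairs:
  fixes R :: "'i::finite \<Rightarrow> 'j::finite \<Rightarrow> bool"
  shows "card {(i, j). R i j} = (\<Sum>i\<in>UNIV. card {j. R i j})"
proof -
  have "{(i, j). R i j} = (SIGMA i:UNIV. {j. R i j})"
    by auto
  then show ?thesis
    by (simp add: card_SigmaI)
qed

lemma card_pairs_swap: "card {(i, j). R i j} = card {(j, i). R i j}"
  by (rule bij_betw_same_card[of prod.swap]) (auto simp: bij_betw_def inj_on_def image_def)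

lemma sum_le_card_mult:
  fixes g :: "'i::finite \<Rightarrow> nat"
  assumes "\<And>i. g i \<le> b"
  shows "(\<Sum>i\<in>UNIV. g i) \<le> CARD('i) * b"
  using sum_bounded_above[of UNIV g b] assms by simp

text \<open>A homogeneous polynomial of degree \<open>n\<close> on the projective line, in the affine coordinate
  \<open>s\<close> of the points \<open>(s : 1)\<close>; \<open>None\<close> is the point \<open>(1 : 0)\<close>.\<close>

definition eval_line :: "nat \<Rightarrow> 'a::comm_semiring_1 poly \<Rightarrow> 'a option \<Rightarrow> 'a" where
  "eval_line n p x = (case x of None \<Rightarrow> coeff p n | Some s \<Rightarrow> poly p s)"

text \<open>The value at \<open>None\<close> is the coefficient of degree \<open>n\<close>. If it
  vanishes, the extra zero at infinity is paid for by the drop in degree.\<close>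

lemma card_eval_line_zeros:
  fixes p :: "'a::{field, finite} poly"
  assumes "p \<noteq> 0" "degree p \<le> n"
  shows "card {x. eval_line n p x = 0} \<le> n"
proof (cases "coeff p n = 0")
  case True
  then have "degree p < n"
    using assms by (metis le_neq_implies_less leading_coeff_0_iff)
  moreover have "{x. eval_line n p x = 0} = insert None (Some ` {s. poly p s = 0})"
  proof (intro set_eqI)
    fix x show "x \<in> {x. eval_line n p x = 0} \<longleftrightarrow> x \<in> insert None (Some ` {s. poly p s = 0})"
      using True by (cases x) (auto simp: eval_line_def)
  qed
  moreover have "card (insert None (Some ` {s. poly p s = 0})) = Suc (card {s. poly p s = 0})"
    by (subst card_insert_disjoint) (auto simp: card_image)
  ultimately show ?thesis
    using card_poly_roots_bound[OF assms(1)] by simp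
next
  case False
  have "{x. eval_line n p x = 0} = Some ` {s. poly p s = 0}"
  proof (intro set_eqI)
    fix x show "x \<in> {x. eval_line n p x = 0} \<longleftrightarrow> x \<in> Some ` {s. poly p s = 0}"
      using False by (cases x) (auto simp: eval_line_def)
  qed
  then show ?thesis
    using card_poly_roots_bound[OF assms(1)] assms(2) by (simp add: card_image)
qed

lemma card_linear_zeros_line:
  fixes a b :: "'a::{field, finite}"
  assumes "a \<noteq> 0 \<or> b \<noteq> 0"
  shows "card {x. (case x of None \<Rightarrow> a | Some s \<Rightarrow> a * s + b) = 0} \<le> 1"
proof -
  have "eval_line 1 [:b, a:] = (\<lambda>x. case x of None \<Rightarrow> a | Some s \<Rightarrow> a * s + b)"
    by (auto simp: eval_line_def fun_eq_iff algebra_simps  split: option.split)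
  moreover have "degree [:b, a:] \<le> 1"
    by (simp add: degree_pCons_eq_if)
  ultimately show ?thesis
    using card_eval_line_zeros[of "[:b, a:]" 1] assms by auto
qed

lemma card_quadratic_zeros_line:
  fixes a b c :: "'a::{field, finite}"
  assumes "a \<noteq> 0 \<or> b \<noteq> 0 \<or> c \<noteq> 0"
  shows "card {x. (case x of None \<Rightarrow> a | Some s \<Rightarrow> a * s\<^sup>2 + b * s + c) = 0} \<le> 2"
proof -
  have "eval_line 2 [:c, b, a:] = (\<lambda>x. case x of None \<Rightarrow> a | Some s \<Rightarrow> a * s\<^sup>2 + b * s + c)"
    by (auto simp: eval_line_def fun_eq_iff algebra_simps eval_nat_numeral split: option.split)
  moreover have "degree [:c, b, a:] \<le> 2"
    by (simp add: degree_pCons_eq_if)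
  ultimately show ?thesis
    using card_eval_line_zeros[of "[:c, b, a:]" 2] assms by auto
qed

lemma card_quartic_zeros_line:
  fixes a b c d e :: "'a::{field, finite}"
  assumes "a \<noteq> 0 \<or> b \<noteq> 0 \<or> c \<noteq> 0 \<or> d \<noteq> 0 \<or> e \<noteq> 0"
  shows "card {x. (case x of None \<Rightarrow> a | Some s \<Rightarrow> a * s^4 + b * s^3 + c * s\<^sup>2 + d * s + e) = 0} \<le> 4"
proof -
  have "eval_line 4 [:e, d, c, b, a:] = (\<lambda>x. case x of None \<Rightarrow> a | Some s \<Rightarrow> a * s^4 + b * s^3 + c * s\<^sup>2 + d * s + e)"
    by (auto simp: eval_line_def fun_eq_iff algebra_simps eval_nat_numeral split: option.split)
  moreover have "degree [:e, d, c, b, a:] \<le> 4"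
    by (simp add: degree_pCons_eq_if)
  ultimately show ?thesis
    using card_eval_line_zeros[of "[:e, d, c, b, a:]" 4] assms by auto
qed

section \<open>Affine equations in one and two variables\<close>

lemma card_linear_zeros:
  fixes a b :: "'a::{field, finite}"
  assumes "b \<noteq> 0"
  shows "card {t. a + b * t = 0} \<le> 1"
proof -
  have "{t. a + b * t = 0} \<subseteq> {- a / b}"
    using assms by (auto simp: field_simps eq_neg_iff_add_eq_0)
  then show ?thesis
    using card_mono[of "{- a / b}"] by simp
qed

lemma card_quadratic_zeros:
  fixes a b c :: "'a::{field, finite}"
  assumes "c \<noteq> 0"
  shows "card {t. a + b * t + c * t\<^sup>2 = 0} \<le> 2"
proof -
  have "{t. a + b * t + c * t\<^sup>2 = 0} = {t. poly [:a, b, c:] t = 0}"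
    by (simp add: algebra_simps power2_eq_square)
  then show ?thesis
    using card_poly_roots_bound[of "[:a, b, c:]"] assms by simp
qed

lemma card_line_plane:
  fixes a b c :: "'a::{field, finite}"
  assumes "b \<noteq> 0 \<or> c \<noteq> 0"
  shows "card {(s, t). a + b * s + c * t = 0} \<le> CARD('a)"
proof -
  have *: "card {(s, t). a + b * s + c * t = 0} \<le> CARD('a)" if "c \<noteq> 0" for b c :: 'a
    unfolding card_pairs
    using sum_le_card_mult[of "\<lambda>s. card {t. a + b * s + c * t = 0}" 1] card_linear_zeros[OF that]
    by simp
  show ?thesis
  proof (cases "c = 0")
    case True
    then show ?thesis
      using *[of b c] assms card_pairs_swap[of "\<lambda>s t. a + b * s + c * t = 0"]
      by (simp add: add_ac)
  qed (rule *)
qed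

text \<open>Each \<open>t\<close> determines \<open>y\<close>, except at the at most one root of
  \<open>a + b * t\<close>, where all \<open>q\<close> values may count: \<open>q + (q - 1)\<close>
  in total.\<close>

lemma card_linear_in_second_zeros:
  fixes a b :: "'a::{field, finite}"
  assumes "a \<noteq> 0 \<or> b \<noteq> 0"
  shows "card {(y, t). g t + (a + b * t) * y = 0} \<le> 2 * CARD('a) - 1"
proof -
  let ?q = "CARD('a)"
  have q: "?q \<ge> 1"
    by (simp add: Suc_leI)
  let ?T = "{t. a + b * t = 0}"
  have T: "card ?T \<le> 1"
    using card_linear_zeros[of b a] assms by (cases "b = 0") auto
  have "card {(y, t). g t + (a + b * t) * y = 0} = (\<Sum>t\<in>UNIV. card {y. g t + (a + b * t) * y = 0})"
    by (subst card_pairs_swap) (rule card_pairs)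
  also have "\<dots> \<le> (\<Sum>t\<in>UNIV. 1 + (if t \<in> ?T then ?q - 1 else 0))"
  proof (rule sum_mono)
    fix t
    show "card {y. g t + (a + b * t) * y = 0} \<le> 1 + (if t \<in> ?T then ?q - 1 else 0)"
      using card_linear_zeros[of "a + b * t" "g t"] card_mono[of UNIV "{y. g t + (a + b * t) * y = 0}"] q
      by auto
  qed
  also have "\<dots> = ?q + card ?T * (?q - 1)"
    unfolding sum.distrib by (simp add: sum.If_cases del: mem_Collect_eq)
  also have "\<dots> \<le> 2 * ?q - 1"
    using T q mult_le_mono1[OF T, of "?q - 1"] by linarith
  finally show ?thesis .
qed

text \<open>A square term allows two values of its variable for each value of the other one. If only
  the product term is left, the equation is linear in \<open>s\<close> with coefficient
  \<open>b + e * t\<close>.\<close>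

lemma card_affine_conic:
  fixes a b c d e g :: "'a::{field, finite}"
  assumes "d \<noteq> 0 \<or> e \<noteq> 0 \<or> g \<noteq> 0"
  shows "card {(s, t). a + b * s + c * t + d * s\<^sup>2 + e * s * t + g * t\<^sup>2 = 0} \<le> 2 * CARD('a)"
proof -
  have *: "card {(s, t). a + b * s + c * t + d * s\<^sup>2 + e * s * t + g * t\<^sup>2 = 0} \<le> 2 * CARD('a)"
    if "g \<noteq> 0" for b c d e g :: 'a
  proof -
    have "card {t. a + b * s + c * t + d * s\<^sup>2 + e * s * t + g * t\<^sup>2 = 0} \<le> 2" for s
      using card_quadratic_zeros[OF that, of "a + b * s + d * s\<^sup>2" "c + e * s"]
      by (simp add: algebra_simps)
    then show ?thesis
      unfolding card_pairs
      using sum_le_card_mult[of "\<lambda>s. card {t. a + b * s + c * t + d * s\<^sup>2 + e * s * t + g * t\<^sup>2 = 0}" 2]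
      by simp
  qed
  show ?thesis
  proof (cases "g = 0")
    case g: True
    show ?thesis
    proof (cases "d = 0")
      case True
      then have "e \<noteq> 0"
        using g assms by simp
      have "card {(s, t). (a + c * t) + (b + e * t) * s = 0} \<le> 2 * CARD('a) - 1"
        by (rule card_linear_in_second_zeros) (use \<open>e \<noteq> 0\<close> in simp)
      then show ?thesis
        using True g by (simp add: algebra_simps)
    next
      case False
      then show ?thesis
        using *[of d c b g e] card_pairs_swap[of "\<lambda>s t. a + b * s + c * t + d * s\<^sup>2 + e * s * t + g * t\<^sup>2 = 0"]
        by (simp add: algebra_simps)
    qed
  qed (rule *)
qed

text \<open>The condition \<open>g \<noteq> 0\<close> says that the conic misses the common point of the lines \<open>y = const\<close>.
  If the conic has a point on the line at infinity (\<open>None\<close>), a shear moves it to \<open>t = 0\<close>, and the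
  affine equation becomes linear in \<open>y\<close>.\<close>

lemma card_conic_missing_point:
  fixes a b c d e g :: "'a::{field, finite}"
  assumes g: "g \<noteq> 0"
  shows "card {(r, t). (case r of None \<Rightarrow> d + e * t + g * t\<^sup>2
      | Some y \<Rightarrow> a + b * y + c * t + d * y\<^sup>2 + e * y * t + g * t\<^sup>2) = 0} \<le> 2 * CARD('a) + 1"
proof -
  let ?q = "CARD('a)"
  let ?F = "\<lambda>y t. a + b * y + c * t + d * y\<^sup>2 + e * y * t + g * t\<^sup>2"
  let ?I = "{t. d + e * t + g * t\<^sup>2 = 0}"
  have q: "?q \<ge> 1"
    by (simp add: Suc_leI)
  have eq: "{(r, t). (case r of None \<Rightarrow> d + e * t + g * t\<^sup>2 | Some y \<Rightarrow> ?F y t) = 0} =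
      (Pair None ` ?I) \<union> (\<lambda>(y, t). (Some y, t)) ` {(y, t). ?F y t = 0}"
    (is "?L = ?R")
  proof (intro set_eqI)
    fix x show "x \<in> ?L \<longleftrightarrow> x \<in> ?R"
      by (cases x; cases "fst x") auto
  qed
  have "card {(r, t). (case r of None \<Rightarrow> d + e * t + g * t\<^sup>2 | Some y \<Rightarrow> ?F y t) = 0} =
      card (Pair (None :: 'a option) ` ?I) + card ((\<lambda>(y, t). (Some y, t)) ` {(y, t). ?F y t = 0})"
    unfolding eq by (rule card_Un_disjoint) auto
  also have "\<dots> = card ?I + card {(y, t). ?F y t = 0}"
    by (intro arg_cong2[where f = "(+)"] card_image) (auto simp: inj_on_def)
  finally have split: "card {(r, t). (case r of None \<Rightarrow> d + e * t + g * t\<^sup>2 | Some y \<Rightarrow> ?F y t) = 0} =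
      card ?I + card {(y, t). ?F y t = 0}" .
  have F: "card {(y, t). ?F y t = 0} \<le> 2 * ?q"
    by (rule card_affine_conic) (use g in simp)
  have I: "card ?I \<le> 2"
    using card_quadratic_zeros[OF g] .
  show ?thesis
  proof (cases "?I = {}")
    case True
    then show ?thesis
      using split F by simp
  next
    case False
    then obtain t0 where t0: "d + e * t0 + g * t0\<^sup>2 = 0"
      by blast
    then have d: "d = - (e * t0) - g * t0\<^sup>2"
      by (simp add: algebra_simps eq_neg_iff_add_eq_0)
    \<comment> \<open>\<open>h\<close> is the derivative at \<open>t0\<close> of the equation at
      infinity. If \<open>k\<close> and \<open>h\<close> are not both 0, the affine part has at most
      \<open>2 * q - 1\<close> points, which leaves room for two at infinity; if both vanish,
      \<open>t0\<close> is a double root and the only point at infinity.\<close>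
    define h where "h = e + 2 * g * t0"
    define k where "k = b + c * t0"
    have shear: "?F y (t + y * t0) = (a + c * t + g * t\<^sup>2) + (k + h * t) * y" for y t
      unfolding d h_def k_def by (simp add: algebra_simps power2_eq_square)
    have "card {(y, t). ?F y t = 0} = card {(y, t). ?F y (t + y * t0) = 0}"
    proof (rule bij_betw_same_card[of "\<lambda>(y, t). (y, t - y * t0)"])
      show "bij_betw (\<lambda>(y, t). (y, t - y * t0)) {(y, t). ?F y t = 0} {(y, t). ?F y (t + y * t0) = 0}"
        by (rule bij_betwI[where g = "\<lambda>(y, t). (y, t + y * t0)"]) auto
    qed
    then have eq: "card {(y, t). ?F y t = 0} = card {(y, t). (a + c * t + g * t\<^sup>2) + (k + h * t) * y = 0}"
      by (simp only: shear)
    show ?thesis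
    proof (cases "k = 0 \<and> h = 0")
      case False
      then have "card {(y, t). ?F y t = 0} \<le> 2 * ?q - 1"
        unfolding eq by (intro card_linear_in_second_zeros) auto
      then show ?thesis
        using split I q by linarith
    next
      case True
      have "?I \<subseteq> {t0}"
      proof
        fix t assume "t \<in> ?I"
        moreover have e: "e = - 2 * g * t0"
          using True by (simp add: h_def eq_neg_iff_add_eq_0)
        have "d + e * t + g * t\<^sup>2 = g * (t - t0)\<^sup>2"
          unfolding d e by (simp add: algebra_simps power2_eq_square)
        ultimately show "t \<in> {t0}"
          using g by simp
      qed
      then have "card ?I \<le> 1"
        using card_mono[of "{t0}" ?I] by simp
      then show ?thesis
        using split F by linarith
    qed
  qed
qed

text \<open>\<open>Z\<close> models the zeros of a form of bidegree (2, 2). A third full row would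
  give every column three zeros and so fill the grid. No full row gives at most 2 (q + 1), one gives
  at most (q + 1) + 2 q. With two full rows the number is 2 (q + 1) + (q - 1) j for j full columns,
  and j = 0, 1, 2 yields 2 q + 2, 3 q + 1, 4 q.\<close>

lemma card_22_zeros:
  fixes Z :: "'p::finite \<Rightarrow> 'p \<Rightarrow> bool"
  assumes q: "CARD('p) = q + 1" "q \<ge> 2"
    and rows: "\<And>p. (\<forall>r. Z p r) \<or> card {r. Z p r} \<le> 2"
    and cols: "\<And>r. (\<forall>p. Z p r) \<or> card {p. Z p r} \<le> 2"
    and not_all: "\<not> (\<forall>p r. Z p r)"
  shows "card {(p, r). Z p r} = 4 * q \<or> card {(p, r). Z p r} \<le> 3 * q + 1"
proof -
  let ?K = "{p. \<forall>r. Z p r}"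
  let ?J = "{r. \<forall>p. Z p r}"
  have "card ?K \<le> 2"
  proof (rule ccontr)
    assume K: "\<not> card ?K \<le> 2"
    have "card ?K \<le> card {p. Z p r}" for r
      by (rule card_mono) auto
    with K have "\<forall>p. Z p r" for r
      using cols[of r] by (meson le_trans)
    with not_all show False by blast
  qed
  have "card {(p, r). Z p r} = (\<Sum>p\<in>UNIV. card {r. Z p r})"
    by (rule card_pairs)
  also have "\<dots> = (\<Sum>p\<in>?K. card {r. Z p r}) + (\<Sum>p\<in>-?K. card {r. Z p r})"
    by (subst sum.union_disjoint[symmetric]) (auto simp: Compl_partition intro!: sum.cong)
  also have "(\<Sum>p\<in>?K. card {r. Z p r}) = card ?K * (q + 1)"
    using q by simp
  finally have n: "card {(p, r). Z p r} = card ?K * (q + 1) + (\<Sum>p\<in>-?K. card {r. Z p r})" .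
  have Kc: "card (- ?K) = q + 1 - card ?K"
    using q by (simp add: Compl_eq_Diff_UNIV card_Diff_subset)
  have "(\<Sum>p\<in>-?K. card {r. Z p r}) \<le> card (- ?K) * 2"
    using sum_bounded_above[of "- ?K" "\<lambda>p. card {r. Z p r}" 2] rows by auto
  then have le: "(\<Sum>p\<in>-?K. card {r. Z p r}) \<le> 2 * (q + 1 - card ?K)"
    unfolding Kc by simp
  consider "card ?K = 0" | "card ?K = 1" | "card ?K = 2"
    using \<open>card ?K \<le> 2\<close> by linarith
  then show ?thesis
  proof cases
    case 1
    show ?thesis
      using n le q unfolding 1 by linarith
  next
    case 2
    have "(\<Sum>p\<in>-?K. card {r. Z p r}) \<le> 2 * q"
      using le unfolding 2 by simp
    then show ?thesis
      using n unfolding 2 mult_1 by linarith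
  next
    case 3
    \<comment> \<open>Two full rows already put two zeros into every column, so a zero in any
      further row fills its column.\<close>
    have J: "{r. Z p r} = ?J" if p: "p \<in> - ?K" for p
    proof
      show "{r. Z p r} \<subseteq> ?J"
      proof
        fix r assume "r \<in> {r. Z p r}"
        then have "card (insert p ?K) \<le> card {p. Z p r}"
          by (intro card_mono) auto
        moreover have "card (insert p ?K) = 3"
          using p 3 by (subst card_insert_disjoint) auto
        ultimately show "r \<in> ?J"
          using cols[of r] by auto
      qed
    qed auto
    have "(\<Sum>p\<in>-?K. card {r. Z p r}) = (q - 1) * card ?J"
      using J Kc 3 by simp
    then have n': "card {(p, r). Z p r} = 2 * (q + 1) + (q - 1) * card ?J"
      using n 3 by simp
    have "card (- ?K) \<noteq> 0"
      using Kc 3 q by simp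
    then obtain p where "p \<in> - ?K"
      by (metis card.empty ex_in_conv)
    then have "card ?J \<le> 2"
      using J[of p] rows[of p] by auto
    then consider "card ?J = 0" | "card ?J = 1" | "card ?J = 2"
      by linarith
    then show ?thesis
      using n' q by cases auto
  qed
qed

lemma card_cone_zeros:
  fixes d :: "'i::finite \<Rightarrow> 'a::{field, finite} ^ 'n::finite"
  assumes Q: "quadratic_map Q"
    and inj: "inj_on (\<lambda>(k, i). k *s d i) ((- {0}) \<times> UNIV)"
  shows "card {x \<in> (\<lambda>(k, i). k *s d i) ` ((- {0}) \<times> UNIV). Q x = 0} =
    (CARD('a) - 1) * card {i. Q (d i) = 0}"
proof -
  have "{x \<in> (\<lambda>(k, i). k *s d i) ` ((- {0}) \<times> UNIV). Q x = 0} =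
      (\<lambda>(k, i). k *s d i) ` ((- {0}) \<times> {i. Q (d i) = 0})"
    using Q by (auto simp: quadratic_map_scale)
  also have "card \<dots> = card ((- {0 :: 'a}) \<times> {i. Q (d i) = 0})"
    by (rule card_image) (rule inj_on_subset[OF inj], auto)
  also have "\<dots> = (CARD('a) - 1) * card {i. Q (d i) = 0}"
    by (simp add: card_cartesian_product Compl_eq_Diff_UNIV card_Diff_subset)
  finally show ?thesis .
qed

lemma card_field_ge_2: "CARD('a::{field, finite}) \<ge> 2"
  using card_mono[of UNIV "{0 :: 'a, 1}"] by simp

subsection \<open>Intersections with the two cones\<close>

text \<open>In the applications \<open>U\<close> is the vertex as a vector subspace and
  \<open>d\<close> picks one vector on each point of the cone off the vertex. Those points thus
  become indices \<open>i\<close>, and only the vertex is still counted in vectors.\<close>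

lemma card_points_cone:
  fixes d :: "'i::finite \<Rightarrow> 'a::{field, finite} ^ 'n::finite"
  assumes Q1: "quadratic_map Q1" and Q2: "quadratic_map Q2"
    and inj: "inj_on (\<lambda>(k, i). k *s d i) ((- {0}) \<times> UNIV)"
    and zeros: "{v. Q1 v = 0} = U \<union> (\<lambda>(k, i). k *s d i) ` ((- {0}) \<times> UNIV)"
    and disj: "U \<inter> (\<lambda>(k, i). k *s d i) ` ((- {0}) \<times> UNIV) = {}" and "0 \<in> U"
  shows "(CARD('a) - 1) * card {P \<in> proj_points. P \<subseteq> {v. Q1 v = 0 \<and> Q2 v = 0}} =
    card {u \<in> U - {0}. Q2 u = 0} + (CARD('a) - 1) * card {i. Q2 (d i) = 0}"
proof -
  define C where "C = (\<lambda>(k, i). k *s d i) ` ((- {0}) \<times> UNIV)"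
  define V where "V = {v. Q1 v = 0}"
  have VC: "V = U \<union> C" "U \<inter> C = {}"
    using zeros disj by (simp_all add: V_def C_def)
  have "(CARD('a) - 1) * card {P \<in> proj_points. P \<subseteq> {v. Q1 v = 0 \<and> Q2 v = 0}} =
      card ({v. Q1 v = 0 \<and> Q2 v = 0} - {0})"
    using Q1 Q2 by (intro card_proj_points_subset) (auto simp: quadratic_map_zero quadratic_map_scale)
  also have "{v. Q1 v = 0 \<and> Q2 v = 0} - {0} = {v \<in> V. Q2 v = 0} - {0}"
    by (simp add: V_def)
  also have "\<dots> = {u \<in> U - {0}. Q2 u = 0} \<union> {x \<in> C. Q2 x = 0}"
    using VC \<open>0 \<in> U\<close> by blast
  also have "card \<dots> = card {u \<in> U - {0}. Q2 u = 0} + card {x \<in> C. Q2 x = 0}"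
    by (intro card_Un_disjoint) (use VC in auto)
  also have "card {x \<in> C. Q2 x = 0} = (CARD('a) - 1) * card {i. Q2 (d i) = 0}"
    unfolding C_def by (rule card_cone_zeros[OF Q2 inj])
  finally show ?thesis .
qed

lemma card_points_rank_3:
  fixes e1 e2 e3 r1 r2 :: "'a::{field, finite} ^ 'n::finite"
  defines "F \<equiv> \<lambda>x y z s t. x *s e1 + y *s e2 + z *s e3 + s *s r1 + t *s r2"
  assumes Q1: "quadratic_map Q1" and Q2: "quadratic_map Q2"
    and inj: "\<And>x y z s t x' y' z' s' t'. F x y z s t = F x' y' z' s' t' \<Longrightarrow>
      x = x' \<and> y = y' \<and> z = z' \<and> s = s' \<and> t = t'"
    and surj: "\<And>v. \<exists>x y z s t. v = F x y z s t"
    and Q1_F: "\<And>x y z s t. Q1 (F x y z s t) = x * z + k * y\<^sup>2" and k: "k \<noteq> 0"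
    and not_multiple: "\<nexists>c. \<forall>v. Q2 v = c * Q1 v"
    and q: "q = CARD('a)"
  defines "n \<equiv> card {P \<in> proj_points. P \<subseteq> {v. Q1 v = 0 \<and> Q2 v = 0}}"
  shows "n = 4 * q\<^sup>2 + q + 1 \<or> n \<le> 3 * q\<^sup>2 + q + 1"
proof -
  have q2: "q \<ge> 2"
    using q card_field_ge_2 by simp
  have scale_F: "c *s F x y z s t = F (c * x) (c * y) (c * z) (c * s) (c * t)" for c x y z s t
    by (simp add: F_def vec.scale_right_distrib)
  \<comment> \<open>One vector per point off the vertex: \<open>None\<close> stands for the point
    \<open>e1\<close> of the conic, \<open>Some w\<close> for \<open>(- k w^2 : w : 1)\<close>, and
    \<open>s\<close>, \<open>t\<close> are affine coordinates on the generator plane minus the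
    vertex line.\<close>
  define d where "d = (\<lambda>(i, s, t). case i of None \<Rightarrow> F 1 0 0 s t | Some w \<Rightarrow> F (- (k * w\<^sup>2)) w 1 s t)"
  define U where "U = range (\<lambda>(s, t). F 0 0 0 s t)"
  let ?C = "(\<lambda>(c, i). c *s d i) ` ((- {0}) \<times> UNIV)"
  have card_U: "card U = q\<^sup>2"
  proof -
    have "card U = CARD('a \<times> 'a)"
      unfolding U_def by (rule card_image) (auto simp: inj_on_def dest: inj)
    then show ?thesis
      by (simp add: q power2_eq_square)
  qed
  have "0 \<in> U"
    unfolding U_def by (rule range_eqI[of _ _ "(0, 0)"]) (simp add: F_def)
  have points: "(q - 1) * n = card {u \<in> U - {0}. Q2 u = 0} + (q - 1) * card {i. Q2 (d i) = 0}"
    unfolding n_def q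
  proof (rule card_points_cone[OF Q1 Q2 _ _ _ \<open>0 \<in> U\<close>])
    show "inj_on (\<lambda>(c, i). c *s d i) ((- {0}) \<times> UNIV)"
    proof (rule inj_onI)
      fix X Y :: "'a \<times> 'a option \<times> 'a \<times> 'a"
      assume XY: "X \<in> (- {0}) \<times> UNIV" "Y \<in> (- {0}) \<times> UNIV"
        "(\<lambda>(c, i). c *s d i) X = (\<lambda>(c, i). c *s d i) Y"
      obtain c i s t c' i' s' t' where "X = (c, i, s, t)" "Y = (c', i', s', t')"
        by (metis surj_pair)
      with XY show "X = Y"
        by (auto simp: d_def scale_F split: option.splits dest!: inj)
    qed
    show "{v. Q1 v = 0} = U \<union> ?C"
    proof (intro set_eqI iffI)
      fix v assume v: "v \<in> {v. Q1 v = 0}"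
      obtain x y z s t where F: "v = F x y z s t"
        using surj by blast
      with v have 0: "x * z + k * y\<^sup>2 = 0"
        by (simp add: Q1_F)
      show "v \<in> U \<union> ?C"
      proof (cases "z = 0")
        case z: True
        then have y: "y = 0"
          using 0 k by simp
        show ?thesis
        proof (cases "x = 0")
          case True
          then have "v = (\<lambda>(s, t). F 0 0 0 s t) (s, t)"
            using F y z by simp
          then show ?thesis
            unfolding U_def by blast
        next
          case False
          then have "v = (\<lambda>(c, i). c *s d i) (x, None, s / x, t / x)"
            using F y z by (simp add: d_def scale_F)
          with False show ?thesis by blast
        qed
      next
        case False
        have "x = z * (- (k * (y / z)\<^sup>2))"
          using 0 False by (simp add: field_simps power2_eq_square eq_neg_iff_add_eq_0)
        then have "v = (\<lambda>(c, i). c *s d i) (z, Some (y / z), s / z, t / z)"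
          using F False by (simp add: d_def scale_F)
        with False show ?thesis by blast
      qed
    next
      fix v assume "v \<in> U \<union> ?C"
      then show "v \<in> {v. Q1 v = 0}"
        by (auto simp: U_def d_def scale_F Q1_F algebra_simps power2_eq_square split: option.splits)
    qed
    show "U \<inter> ?C = {}"
      by (auto simp: U_def d_def scale_F split: option.splits dest!: inj)
  qed
  define M where "M = card {i. Q2 (d i) = 0}"
  have sq: "q\<^sup>2 - 1 = (q - 1) * (q + 1)"
    by (simp add: power2_eq_square algebra_simps)
  have cU: "card (U - {0}) = (q - 1) * (q + 1)"
    using card_U \<open>0 \<in> U\<close> sq by (simp add: card_Diff_singleton)
  have n_le: "n \<le> M + (q + 1)"
  proof -
    have "card {u \<in> U - {0}. Q2 u = 0} \<le> card (U - {0})"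
      by (rule card_mono) auto
    then have "(q - 1) * n \<le> (q - 1) * (M + (q + 1))"
      using points unfolding cU M_def by (simp only: distrib_left)
    moreover have "0 < q - 1"
      using q2 by simp
    ultimately show ?thesis
      by (metis nat_mult_le_cancel1)
  qed
  have n_eq: "n = M + (q + 1)" if "\<And>u. u \<in> U \<Longrightarrow> Q2 u = 0"
  proof -
    have "{u \<in> U - {0}. Q2 u = 0} = U - {0}"
      using that by blast
    then have "(q - 1) * n = (q - 1) * (M + (q + 1))"
      using points unfolding M_def by (simp only: distrib_left cU)
    moreover have "0 < q - 1"
      using q2 by simp
    ultimately show ?thesis
      by (metis nat_mult_eq_cancel1)
  qed
  define p where "p i = (case i of None \<Rightarrow> e1 | Some w \<Rightarrow> (- (k * w\<^sup>2)) *s e1 + w *s e2 + e3)" for i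
  let ?N = "\<lambda>i. card {(s, t). Q2 (p i + s *s r1 + t *s r2) = 0}"
  have M: "M = (\<Sum>i\<in>UNIV. ?N i)"
  proof -
    have "{i. Q2 (d i) = 0} = {(i, st). case st of (s, t) \<Rightarrow> Q2 (p i + s *s r1 + t *s r2) = 0}"
      by (auto simp: d_def p_def F_def split: option.splits)
    then show ?thesis
      unfolding M_def by (simp only: card_pairs)
  qed
  note simps = quadratic_map_simps[OF Q2] polar_commute[of Q2 r2 r1] polar_commute[of Q2 e2 e1]
    polar_commute[of Q2 e3 e1] polar_commute[of Q2 e3 e2] polar_commute[of Q2 r1 e1]
    polar_commute[of Q2 r1 e2] polar_commute[of Q2 r1 e3] polar_commute[of Q2 r2 e1]
    polar_commute[of Q2 r2 e2] polar_commute[of Q2 r2 e3]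
  have expand: "Q2 (p + s *s r1 + t *s r2) = Q2 p + polar Q2 p r1 * s + polar Q2 p r2 * t
      + Q2 r1 * s\<^sup>2 + polar Q2 r1 r2 * s * t + Q2 r2 * t\<^sup>2" for p s t
    by (simp add: simps algebra_simps)
  have card_opt: "CARD('a option) = q + 1"
    by (simp add: q)
  show ?thesis
  proof (cases "Q2 r1 \<noteq> 0 \<or> polar Q2 r1 r2 \<noteq> 0 \<or> Q2 r2 \<noteq> 0")
    case True
    \<comment> \<open>The quadratic part of \<open>Q2\<close> on each of the \<open>q + 1\<close>
      affine planes is its restriction to the vertex, here a nonzero form.\<close>
    have "?N i \<le> 2 * q" for i
      unfolding expand q by (rule card_affine_conic[OF True])
    then have "M \<le> (q + 1) * (2 * q)"
      unfolding M card_opt[symmetric] by (rule sum_le_card_mult)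
    then have "n \<le> (q + 1) * (2 * q) + (q + 1)"
      using n_le by linarith
    also have "\<dots> \<le> 3 * q\<^sup>2 + q + 1"
      using mult_le_mono1[OF q2, of q] by (simp add: power2_eq_square algebra_simps)
    finally show ?thesis ..
  next
    case False
    then have r: "Q2 r1 = 0" "Q2 r2 = 0" "polar Q2 r1 r2 = 0"
      by auto
    have n: "n = M + (q + 1)"
    proof (rule n_eq)
      fix u assume "u \<in> U"
      then show "Q2 u = 0"
        by (auto simp: U_def F_def simps r)
    qed
    have expand': "Q2 (p + s *s r1 + t *s r2) = Q2 p + polar Q2 p r1 * s + polar Q2 p r2 * t" for p s t
      unfolding expand by (simp add: r)
    let ?deg = "\<lambda>r. polar Q2 e1 r = 0 \<and> polar Q2 e2 r = 0 \<and> polar Q2 e3 r = 0"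
    show ?thesis
    proof (cases "?deg r1 \<and> ?deg r2")
      case False
      then obtain r where r: "r = r1 \<or> r = r2" "\<not> ?deg r"
        by blast
      \<comment> \<open>\<open>Q2\<close> is affine linear on each generator, and constant only over
        \<open>?T\<close>. Along the conic \<open>polar Q2 (p i) r\<close> is a binary quadratic
        form, nonzero because \<open>k \<noteq> 0\<close>, so at most two planes count
        \<open>q^2\<close> points and the others \<open>q\<close>: the sum is at most
        \<open>(q + 1) * q + 2 * (q^2 - q)\<close>.\<close>
      let ?T = "{i. polar Q2 (p i) r1 = 0 \<and> polar Q2 (p i) r2 = 0}"
      have "card ?T \<le> 2"
      proof -
        have "?T \<subseteq> {i. (case i of None \<Rightarrow> - (k * polar Q2 e1 r)
            | Some w \<Rightarrow> - (k * polar Q2 e1 r) * w\<^sup>2 + polar Q2 e2 r * w + polar Q2 e3 r) = 0}"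
        proof
          fix i assume "i \<in> ?T"
          then have "polar Q2 (p i) r = 0"
            using r(1) by auto
          then show "i \<in> {i. (case i of None \<Rightarrow> - (k * polar Q2 e1 r)
            | Some w \<Rightarrow> - (k * polar Q2 e1 r) * w\<^sup>2 + polar Q2 e2 r * w + polar Q2 e3 r) = 0}"
            by (cases i) (auto simp: p_def simps algebra_simps)
        qed
        then have "card ?T \<le> card {i. (case i of None \<Rightarrow> - (k * polar Q2 e1 r)
            | Some w \<Rightarrow> - (k * polar Q2 e1 r) * w\<^sup>2 + polar Q2 e2 r * w + polar Q2 e3 r) = 0}"
          by (intro card_mono) auto
        also have "\<dots> \<le> 2"
          by (rule card_quadratic_zeros_line) (use r k in auto)
        finally show ?thesis .
      qed
      have "?N i \<le> q + (if i \<in> ?T then q * (q - 1) else 0)" for i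
      proof (cases "i \<in> ?T")
        case True
        have "?N i \<le> CARD('a \<times> 'a)"
          by (rule card_mono) auto
        then show ?thesis
          using True q2 by (simp add: q algebra_simps)
      next
        case False
        then have "?N i \<le> q"
          unfolding expand' q by (intro card_line_plane) auto
        then show ?thesis
          by simp
      qed
      then have "M \<le> (\<Sum>i\<in>UNIV. q + (if i \<in> ?T then q * (q - 1) else 0))"
        unfolding M by (intro sum_mono)
      also have "\<dots> = (q + 1) * q + card ?T * (q * (q - 1))"
        unfolding sum.distrib by (simp add: sum.If_cases q del: mem_Collect_eq)
      also have "\<dots> \<le> (q + 1) * q + 2 * (q * (q - 1))"
        using \<open>card ?T \<le> 2\<close> by (intro add_left_mono mult_le_mono1)
      finally have "M \<le> (q + 1) * q + 2 * (q * (q - 1))" .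
      then have "M \<le> q * q + q + 2 * (q * q - q)"
        by (simp add: diff_mult_distrib2)
      moreover have "q \<le> q * q"
        by simp
      ultimately have "M \<le> 3 * (q * q)"
        by linarith
      then have "n \<le> 3 * q\<^sup>2 + q + 1"
        by (simp add: n power2_eq_square)
      then show ?thesis ..
    next
      case True
      let ?T = "{i. Q2 (p i) = 0}"
      have const: "Q2 (p i + s *s r1 + t *s r2) = Q2 (p i)" for i s t
        unfolding expand' using True by (cases i) (auto simp: p_def simps)
      have "?N i = (if i \<in> ?T then q\<^sup>2 else 0)" for i
        unfolding const by (auto simp: q power2_eq_square)
      then have M': "M = card ?T * q\<^sup>2"
        unfolding M by (simp add: sum.If_cases del: mem_Collect_eq)
      \<comment> \<open>The pullback to the conic is a binary quartic. Its value at
        \<open>None\<close> has to be the leading coefficient, hence the factor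
        \<open>k\<^sup>2\<close>, which does not change the zeros.\<close>
      have Q2_p: "Q2 (p i) = 0 \<longleftrightarrow> (case i of None \<Rightarrow> k\<^sup>2 * Q2 e1 | Some w \<Rightarrow>
          k\<^sup>2 * Q2 e1 * w^4 + (- (k * polar Q2 e1 e2)) * w^3 +
          (Q2 e2 - k * polar Q2 e1 e3) * w\<^sup>2 + polar Q2 e2 e3 * w + Q2 e3) = 0" for i
        using k by (cases i) (simp_all add: p_def simps algebra_simps eval_nat_numeral)
      have "card ?T \<le> 4"
      proof (rule ccontr)
        assume "\<not> card ?T \<le> 4"
        \<comment> \<open>Five zeros force all coefficients of the quartic to vanish. What remains
          of \<open>Q2\<close> are the coefficients of \<open>x z\<close> and \<open>y^2\<close>,
          tied together by the coefficient of \<open>w\<^sup>2\<close>: a multiple of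
          \<open>Q1\<close>.\<close>
        then have "\<not> (k\<^sup>2 * Q2 e1 \<noteq> 0 \<or> - (k * polar Q2 e1 e2) \<noteq> 0 \<or>
          Q2 e2 - k * polar Q2 e1 e3 \<noteq> 0 \<or> polar Q2 e2 e3 \<noteq> 0 \<or> Q2 e3 \<noteq> 0)"
          unfolding Q2_p using card_quartic_zeros_line by blast
        then have 0: "Q2 e1 = 0" "polar Q2 e1 e2 = 0" "Q2 e2 = k * polar Q2 e1 e3"
          "polar Q2 e2 e3 = 0" "Q2 e3 = 0"
          using k by auto
        have "Q2 v = polar Q2 e1 e3 * Q1 v" for v
        proof -
          obtain x y z s t where v: "v = F x y z s t"
            using surj by blast
          show ?thesis
            unfolding v Q1_F
            by (simp add: F_def simps 0 r True algebra_simps)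
        qed
        with not_multiple show False by blast
      qed
      then consider "card ?T = 4" | "card ?T \<le> 3"
        by linarith
      then show ?thesis
      proof cases
        case 1
        then show ?thesis
          by (simp add: n M')
      next
        case 2
        then have "card ?T * q\<^sup>2 \<le> 3 * q\<^sup>2"
          by (rule mult_le_mono1)
        then show ?thesis
          by (simp add: n M')
      qed
    qed
  qed
qed


lemma card_points_rank_4:
  fixes e1 f1 e2 f2 v :: "'a::{field, finite} ^ 'n::finite"
  defines "F \<equiv> \<lambda>x1 y1 x2 y2 t. x1 *s e1 + y1 *s f1 + x2 *s e2 + y2 *s f2 + t *s v"
  assumes Q1: "quadratic_map Q1" and Q2: "quadratic_map Q2"
    and inj: "\<And>x1 y1 x2 y2 t x1' y1' x2' y2' t'. F x1 y1 x2 y2 t = F x1' y1' x2' y2' t' \<Longrightarrow>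
      x1 = x1' \<and> y1 = y1' \<and> x2 = x2' \<and> y2 = y2' \<and> t = t'"
    and surj: "\<And>w. \<exists>x1 y1 x2 y2 t. w = F x1 y1 x2 y2 t"
    and Q1_F: "\<And>x1 y1 x2 y2 t. Q1 (F x1 y1 x2 y2 t) = x1 * y1 + x2 * y2"
    and not_multiple: "\<nexists>c. \<forall>w. Q2 w = c * Q1 w"
    and q: "q = CARD('a)"
  defines "n \<equiv> card {P \<in> proj_points. P \<subseteq> {w. Q1 w = 0 \<and> Q2 w = 0}}"
  shows "n = 4 * q\<^sup>2 + 1 \<or> n \<le> 3 * q\<^sup>2 + q + 1"
proof -
  have q2: "q \<ge> 2"
    using q card_field_ge_2 by simp
  have card_opt: "CARD('a option) = q + 1"
    by (simp add: q)
  have scale_F: "c *s F x1 y1 x2 y2 t = F (c * x1) (c * y1) (c * x2) (c * y2) (c * t)" for c x1 y1 x2 y2 t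
    by (simp add: F_def vec.scale_right_distrib)
  \<comment> \<open>\<open>(a p : b p)\<close> are the normalised homogeneous coordinates of a point
    of the projective line, \<open>(1 : 0)\<close> or \<open>(s : 1)\<close>.\<close>
  define a where "a p = (case p of None \<Rightarrow> 1 | Some s \<Rightarrow> s)" for p :: "'a option"
  define b where "b p = (case p of None \<Rightarrow> 0 :: 'a | Some s \<Rightarrow> 1)" for p :: "'a option"
  have ab [simp]: "a None = 1" "b None = 0" "a (Some s) = s" "b (Some s) = 1" for s
    by (simp_all add: a_def b_def)
  \<comment> \<open>The Segre map, with a sign on the last coordinate so that
    \<open>x1 * y1 + x2 * y2\<close> cancels; \<open>t\<close> is the affine coordinate on the
    generator line minus the vertex.\<close>
  define d where "d = (\<lambda>((p, r), t). F (a p * a r) (b p * b r) (a p * b r) (- (b p * a r)) t)"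
  define U where "U = range (F 0 0 0 0)"
  let ?C = "(\<lambda>(c, i). c *s d i) ` ((- {0}) \<times> UNIV)"
  have card_U: "card U = q"
    unfolding U_def q by (rule card_image) (auto simp: inj_on_def dest: inj)
  have "0 \<in> U"
    unfolding U_def by (rule range_eqI[of _ _ 0]) (simp add: F_def)
  have points: "(q - 1) * n = card {u \<in> U - {0}. Q2 u = 0} + (q - 1) * card {i. Q2 (d i) = 0}"
    unfolding n_def q
  proof (rule card_points_cone[OF Q1 Q2 _ _ _ \<open>0 \<in> U\<close>])
    show "inj_on (\<lambda>(c, i). c *s d i) ((- {0}) \<times> UNIV)"
    proof (rule inj_onI)
      fix X Y :: "'a \<times> ('a option \<times> 'a option) \<times> 'a"
      assume XY: "X \<in> (- {0}) \<times> UNIV" "Y \<in> (- {0}) \<times> UNIV"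
        "(\<lambda>(c, i). c *s d i) X = (\<lambda>(c, i). c *s d i) Y"
      obtain c p r t c' p' r' t' where *: "X = (c, (p, r), t)" "Y = (c', (p', r'), t')"
        by (metis surj_pair)
      with XY have "c \<noteq> 0" "c' \<noteq> 0"
        "F (c * (a p * a r)) (c * (b p * b r)) (c * (a p * b r)) (c * - (b p * a r)) (c * t) =
         F (c' * (a p' * a r')) (c' * (b p' * b r')) (c' * (a p' * b r')) (c' * - (b p' * a r')) (c' * t')"
        by (auto simp: d_def scale_F)
      then show "X = Y"
        using inj[OF \<open>F (c * _) _ _ _ _ = _\<close>] unfolding *
        by (cases p; cases r; cases p'; cases r') auto
    qed
    show "{w. Q1 w = 0} = U \<union> ?C"
    proof (intro set_eqI iffI)
      fix w assume w: "w \<in> {w. Q1 w = 0}"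
      obtain x1 y1 x2 y2 t where F: "w = F x1 y1 x2 y2 t"
        using surj by blast
      with w have 0: "x1 * y1 + x2 * y2 = 0"
        by (simp add: Q1_F)
      \<comment> \<open>The scalar \<open>c\<close> is, up to sign, the first nonzero one of
        \<open>y1\<close>, \<open>x2\<close>, \<open>y2\<close>, \<open>x1\<close>. Which one it is
        tells which of \<open>p\<close> and \<open>r\<close> are \<open>None\<close>:
        \<open>y1\<close> is nonzero exactly when neither is.\<close>
      have in_C: "w \<in> ?C" if "c \<noteq> 0" "x1 = c * (a p * a r)" "y1 = c * (b p * b r)"
        "x2 = c * (a p * b r)" "y2 = - (c * (b p * a r))" for c p r
      proof -
        have "w = (\<lambda>(c, i). c *s d i) (c, (p, r), t / c)"
          using that by (simp add: F d_def scale_F)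
        then show ?thesis
          using that(1) by blast
      qed
      have "w \<in> U" if "x1 = 0" "y1 = 0" "x2 = 0" "y2 = 0"
        unfolding U_def F that by simp
      moreover have "w \<in> ?C" if "y1 \<noteq> 0"
        by (rule in_C[of y1 "Some (x2 / y1)" "Some (- y2 / y1)"])
          (use that 0 in \<open>auto simp: field_simps eq_neg_iff_add_eq_0\<close>)
      moreover have "w \<in> ?C" if "y1 = 0" "x2 \<noteq> 0"
        by (rule in_C[of x2 None "Some (x1 / x2)"]) (use that 0 in auto)
      moreover have "w \<in> ?C" if "y1 = 0" "x2 = 0" "y2 \<noteq> 0"
        by (rule in_C[of "- y2" "Some (- x1 / y2)" None]) (use that 0 in auto)
      moreover have "w \<in> ?C" if "y1 = 0" "x2 = 0" "y2 = 0" "x1 \<noteq> 0"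
        by (rule in_C[of x1 None None]) (use that 0 in auto)
      ultimately show "w \<in> U \<union> ?C"
        by blast
    next
      fix w assume "w \<in> U \<union> ?C"
      then show "w \<in> {w. Q1 w = 0}"
        by (auto simp: U_def d_def scale_F Q1_F algebra_simps)
    qed
    show "U \<inter> ?C = {}"
    proof -
      have False if "F 0 0 0 0 t' = F (c * (a p * a r)) (c * (b p * b r)) (c * (a p * b r)) (- (c * (b p * a r))) (c * t)" "c \<noteq> 0"
        for c p r t t'
        using inj[OF that(1)] that(2) by (cases p; cases r) auto
      then show ?thesis
        by (auto simp: U_def d_def scale_F) blast
    qed
  qed
  define M where "M = card {i. Q2 (d i) = 0}"
  have cU: "card (U - {0}) = q - 1"
    using card_U \<open>0 \<in> U\<close> by (simp add: card_Diff_singleton)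
  define h where "h = (\<lambda>(p, r). (a p * a r) *s e1 + (b p * b r) *s f1 + (a p * b r) *s e2 + (- (b p * a r)) *s f2)"
  have d_h: "d (i, t) = h i + t *s v" for i t
    by (cases i) (simp add: d_def h_def F_def)
  \<comment> \<open>\<open>A p\<close> and \<open>B p\<close> span the line of the base that belongs
    to \<open>p\<close> in one ruling, and \<open>(a r : b r)\<close> are the coordinates on it.
    Together with \<open>v\<close> they span a generator plane of the cone.\<close>
  define A where "A p = a p *s e1 - b p *s f2" for p
  define B where "B p = a p *s e2 + b p *s f1" for p
  have h_AB: "h (p, r) = a r *s A p + b r *s B p" for p r
    by (simp add: h_def A_def B_def algebra_simps vec.scale_right_distrib vec.scale_right_diff_distrib)
  let ?N = "\<lambda>i. card {t. Q2 (h i + t *s v) = 0}"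
  have M: "M = (\<Sum>i\<in>UNIV. ?N i)"
  proof -
    have "{i. Q2 (d i) = 0} = {(i, t). Q2 (h i + t *s v) = 0}"
      by (auto simp: d_h)
    then show ?thesis
      unfolding M_def by (simp only: card_pairs)
  qed
  note simps = quadratic_map_simps[OF Q2] polar_commute[of Q2 v "A p" for p]
    polar_commute[of Q2 v "B p" for p] polar_commute[of Q2 "B p" "A p" for p]
    polar_commute[of Q2 v e1] polar_commute[of Q2 v f1] polar_commute[of Q2 v e2]
    polar_commute[of Q2 v f2] polar_commute[of Q2 f1 e1] polar_commute[of Q2 e2 e1]
    polar_commute[of Q2 f2 e1] polar_commute[of Q2 e2 f1] polar_commute[of Q2 f2 f1]
    polar_commute[of Q2 f2 e2]
  show ?thesis
  proof (cases "Q2 v = 0")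
    case False
    have "{u \<in> U - {0}. Q2 u = 0} = {}"
      using False by (auto simp: U_def F_def simps)
    then have "(q - 1) * n = (q - 1) * M"
      using points by (simp add: M_def)
    then have n: "n = M"
      using q2 by simp
    \<comment> \<open>Two zeros on each generator line would only give \<open>2 * (q + 1)^2\<close>,
      which exceeds \<open>3 * q^2 + q + 1\<close> for q = 2 and q = 3. In the generator plane of
      \<open>p\<close> the zeros form a conic that misses \<open>v\<close>, and counting by planes
      saves one point in each.\<close>
    have "card {(r, t). Q2 (h (p, r) + t *s v) = 0} \<le> 2 * q + 1" for p
    proof -
      have "{(r, t). Q2 (h (p, r) + t *s v) = 0} =
        {(r, t). (case r of None \<Rightarrow> Q2 (A p) + polar Q2 (A p) v * t + Q2 v * t\<^sup>2
        | Some y \<Rightarrow> Q2 (B p) + polar Q2 (A p) (B p) * y + polar Q2 (B p) v * t + Q2 (A p) * y\<^sup>2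
            + polar Q2 (A p) v * y * t + Q2 v * t\<^sup>2) = 0}"
        (is "?L = ?R")
      proof (intro set_eqI)
        fix x show "x \<in> ?L \<longleftrightarrow> x \<in> ?R"
          by (cases x; cases "fst x") (auto simp: h_AB simps algebra_simps)
      qed
      then show ?thesis
        using card_conic_missing_point[OF False] by (simp only: q)
    qed
    moreover have "M = (\<Sum>p\<in>UNIV. card {(r, t). Q2 (h (p, r) + t *s v) = 0})"
      unfolding card_pairs M UNIV_Times_UNIV[symmetric] sum.cartesian_product
      by (intro sum.cong) auto
    ultimately have "M \<le> (q + 1) * (2 * q + 1)"
      unfolding card_opt[symmetric] by (simp only:) (rule sum_le_card_mult)
    also have "\<dots> \<le> 3 * q\<^sup>2 + q + 1"
      using mult_le_mono1[OF q2, of q] by (simp add: power2_eq_square algebra_simps)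
    finally show ?thesis
      using n by simp
  next
    case v: True
    have "{u \<in> U - {0}. Q2 u = 0} = U - {0}"
      using v by (auto simp: U_def F_def simps)
    then have "(q - 1) * n = (q - 1) * (M + 1)"
      using points by (simp add: M_def cU)
    then have n: "n = M + 1"
      using q2 by (metis nat_mult_eq_cancel1 One_nat_def Suc_1 Suc_le_eq zero_less_diff)
    have expand: "Q2 (p + t *s v) = Q2 p + polar Q2 p v * t" for p t
      by (simp add: simps v)
    show ?thesis
    proof (cases "polar Q2 e1 v = 0 \<and> polar Q2 f2 v = 0 \<and> polar Q2 e2 v = 0 \<and> polar Q2 f1 v = 0")
      case False
      \<comment> \<open>\<open>?T\<close> is cut out on the base by the linear form
        \<open>polar Q2 _ v\<close>, which has bidegree (1, 1) in \<open>(p, r)\<close>. Rows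
        outside \<open>?S\<close> contain at most one element of it. At most one row lies in
        \<open>?S\<close>, since there two linear forms in \<open>(a p : b p)\<close>, not both
        zero, vanish together. A generator over \<open>?T\<close> counts at most \<open>q\<close>
        points, any other at most one.\<close>
      let ?T = "{i. polar Q2 (h i) v = 0}"
      let ?S = "{p. polar Q2 (A p) v = 0 \<and> polar Q2 (B p) v = 0}"
      have "card ?S \<le> 1"
      proof -
        have S: "card ?S \<le> 1" if "k \<noteq> 0 \<or> l \<noteq> 0"
          "?S \<subseteq> {p. (case p of None \<Rightarrow> k | Some s \<Rightarrow> k * s + l) = 0}" for k l
          using card_mono[OF finite that(2)] card_linear_zeros_line[OF that(1)] by (rule le_trans)
        show ?thesis
        proof (cases "polar Q2 e1 v = 0 \<and> polar Q2 f2 v = 0")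
          case True
          show ?thesis
            by (rule S[of "polar Q2 e2 v" "polar Q2 f1 v"])
              (use True False in \<open>auto simp: B_def simps algebra_simps split: option.splits\<close>)
        next
          case False
          show ?thesis
            by (rule S[of "polar Q2 e1 v" "- polar Q2 f2 v"])
              (use False in \<open>auto simp: A_def simps algebra_simps split: option.splits\<close>)
        qed
      qed
      have "card ?T = (\<Sum>p\<in>UNIV. card {r. polar Q2 (h (p, r)) v = 0})"
        using card_pairs[of "\<lambda>p r. polar Q2 (h (p, r)) v = 0"] by (simp add: case_prod_unfold)
      also have "\<dots> \<le> (\<Sum>p\<in>UNIV. 1 + (if p \<in> ?S then q else 0))"
      proof (rule sum_mono)
        fix p
        show "card {r. polar Q2 (h (p, r)) v = 0} \<le> 1 + (if p \<in> ?S then q else 0)"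
        proof (cases "p \<in> ?S")
          case True
          then show ?thesis
            using card_mono[of UNIV "{r. polar Q2 (h (p, r)) v = 0}"] card_opt by simp
        next
          case False
          have "{r. polar Q2 (h (p, r)) v = 0} =
            {r. (case r of None \<Rightarrow> polar Q2 (A p) v | Some s \<Rightarrow> polar Q2 (A p) v * s + polar Q2 (B p) v) = 0}"
            (is "?L = ?R")
          proof (intro set_eqI)
            fix r show "r \<in> ?L \<longleftrightarrow> r \<in> ?R"
              by (cases r) (auto simp: h_AB simps algebra_simps)
          qed
          then have "card {r. polar Q2 (h (p, r)) v = 0} \<le> 1"
            using card_linear_zeros_line[of "polar Q2 (A p) v" "polar Q2 (B p) v"] False by auto
          then show ?thesis by simp
        qed
      qed
      also have "\<dots> = q + 1 + card ?S * q"
        unfolding sum.distrib by (simp add: sum.If_cases q del: mem_Collect_eq)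
      also have "\<dots> \<le> q + 1 + 1 * q"
        using \<open>card ?S \<le> 1\<close> by (intro add_left_mono mult_le_mono1)
      finally have T: "card ?T \<le> 2 * q + 1" by simp
      have "?N i \<le> 1 + (if i \<in> ?T then q - 1 else 0)" for i
      proof (cases "i \<in> ?T")
        case True
        have "?N i \<le> q"
          unfolding q by (rule card_mono) auto
        then show ?thesis
          using True q2 by simp
      next
        case False
        then have "?N i \<le> 1"
          unfolding expand by (intro card_linear_zeros) auto
        then show ?thesis by simp
      qed
      then have "M \<le> (\<Sum>i\<in>UNIV. 1 + (if i \<in> ?T then q - 1 else 0))"
        unfolding M by (intro sum_mono)
      also have "\<dots> = (q + 1) * (q + 1) + card ?T * (q - 1)"
        unfolding sum.distrib by (simp add: sum.If_cases q del: mem_Collect_eq)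
      also have "\<dots> \<le> (q + 1) * (q + 1) + (2 * q + 1) * (q - 1)"
        using T by (intro add_left_mono mult_le_mono1)
      also have "\<dots> = 3 * q\<^sup>2 + q"
      proof -
        obtain m where "q = Suc m"
          using q2 by (cases q) auto
        then show ?thesis
          by (simp add: power2_eq_square)
      qed
      finally show ?thesis
        using n by simp
    next
      case v': True
      let ?Z = "\<lambda>p r. Q2 (h (p, r)) = 0"
      have const: "Q2 (h i + t *s v) = Q2 (h i)" for i t
        unfolding expand using v' by (cases i) (simp add: h_def simps)
      have "?N i = (if i \<in> {(p, r). ?Z p r} then q else 0)" for i
        unfolding const by (cases i) (simp add: q)
      then have M': "M = card {(p, r). ?Z p r} * q"
        unfolding M by (simp add: sum.If_cases del: mem_Collect_eq)
      have zeros: "(\<forall>x. g x = 0) \<or> card {x. g x = 0} \<le> 2"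
        if g: "\<And>x. g x = (case x of None \<Rightarrow> k | Some s \<Rightarrow> k * s\<^sup>2 + l * s + m)" for g and k l m :: 'a
        unfolding g using card_quadratic_zeros_line[of k l m]
        by (cases "k = 0 \<and> l = 0 \<and> m = 0") (auto split: option.splits)
      have "card {(p, r). ?Z p r} = 4 * q \<or> card {(p, r). ?Z p r} \<le> 3 * q + 1"
      proof (rule card_22_zeros[OF card_opt q2])
        fix p
        show "(\<forall>r. ?Z p r) \<or> card {r. ?Z p r} \<le> 2"
          by (rule zeros[of _ "Q2 (A p)" "polar Q2 (A p) (B p)" "Q2 (B p)"])
            (auto simp: h_AB simps algebra_simps split: option.splits)
      next
        fix r
        \<comment> \<open>The line that belongs to \<open>r\<close> in the opposite ruling; this
          makes \<open>h\<close> linear in the coordinates of \<open>p\<close>.\<close>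
        define C where "C = a r *s e1 + b r *s e2"
        define D where "D = b r *s f1 - a r *s f2"
        have "h (p, r) = a p *s C + b p *s D" for p
          by (simp add: h_def C_def D_def algebra_simps vec.scale_right_distrib vec.scale_right_diff_distrib)
        then show "(\<forall>p. ?Z p r) \<or> card {p. ?Z p r} \<le> 2"
          by (intro zeros[of _ "Q2 C" "polar Q2 C D" "Q2 D"])
            (auto simp: simps algebra_simps split: option.splits)
      next
        show "\<not> (\<forall>p r. ?Z p r)"
        proof
          assume Z: "\<forall>p r. ?Z p r"
          \<comment> \<open>The nine points with \<open>p\<close> and \<open>r\<close> among
            \<open>None\<close>, \<open>Some 0\<close>, \<open>Some 1\<close> exist even for
            \<open>q = 2\<close> and determine a form of bidegree (2, 2). Only the common value of
            \<open>polar Q2 e1 f1\<close> and \<open>polar Q2 e2 f2\<close> stays free, and it is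
            the factor of \<open>Q1\<close>.\<close>
          have Z0: "Q2 e1 = 0" "Q2 f1 = 0" "Q2 e2 = 0" "Q2 f2 = 0"
            using Z[rule_format, of None None] Z[rule_format, of "Some 0" "Some 0"]
              Z[rule_format, of None "Some 0"] Z[rule_format, of "Some 0" None]
            by (simp_all add: h_def simps)
          have Z1: "polar Q2 e1 e2 = 0" "polar Q2 e1 f2 = 0" "polar Q2 f1 e2 = 0" "polar Q2 f1 f2 = 0"
            using Z[rule_format, of None "Some 1"] Z[rule_format, of "Some 1" None]
              Z[rule_format, of "Some 1" "Some 0"] Z[rule_format, of "Some 0" "Some 1"]
            by (simp_all add: h_def simps Z0)
          have Z2: "polar Q2 e2 f2 = polar Q2 e1 f1"
            using Z[rule_format, of "Some 1" "Some 1"]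
            by (simp add: h_def simps Z0 Z1)
          have "Q2 w = polar Q2 e1 f1 * Q1 w" for w
          proof -
            obtain x1 y1 x2 y2 t where w: "w = F x1 y1 x2 y2 t"
              using surj by blast
            show ?thesis
              unfolding w Q1_F by (simp add: F_def simps Z0 Z1 Z2 v v' algebra_simps)
          qed
          with not_multiple show False by blast
        qed
      qed
      then show ?thesis
      proof
        assume "card {(p, r). ?Z p r} = 4 * q"
        then show ?thesis
          by (simp add: n M' power2_eq_square)
      next
        assume "card {(p, r). ?Z p r} \<le> 3 * q + 1"
        then have "card {(p, r). ?Z p r} * q \<le> (3 * q + 1) * q"
          by (rule mult_le_mono1)
        then show ?thesis
          by (simp add: n M' power2_eq_square algebra_simps)
      qed
    qed
  qed
qed

subsection \<open>Normal forms\<close>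

text \<open>Independence makes \<open>F\<close> injective on five coordinates; equality of
  cardinalities then makes it onto.\<close>

lemma five_independent_coordinates:
  fixes e1 e2 e3 e4 e5 :: "'a::{field, finite} ^ 5"
  defines "F \<equiv> \<lambda>x1 x2 x3 x4 x5. x1 *s e1 + x2 *s e2 + x3 *s e3 + x4 *s e4 + x5 *s e5"
  assumes indep: "\<And>x1 x2 x3 x4 x5. F x1 x2 x3 x4 x5 = 0 \<Longrightarrow>
    x1 = 0 \<and> x2 = 0 \<and> x3 = 0 \<and> x4 = 0 \<and> x5 = 0"
  shows "F x1 x2 x3 x4 x5 = F y1 y2 y3 y4 y5 \<Longrightarrow> x1 = y1 \<and> x2 = y2 \<and> x3 = y3 \<and> x4 = y4 \<and> x5 = y5"
    and "\<exists>x1 x2 x3 x4 x5. v = F x1 x2 x3 x4 x5"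
proof -
  have inj: "x1 = y1 \<and> x2 = y2 \<and> x3 = y3 \<and> x4 = y4 \<and> x5 = y5"
    if "F x1 x2 x3 x4 x5 = F y1 y2 y3 y4 y5" for x1 x2 x3 x4 x5 y1 y2 y3 y4 y5
  proof -
    have "F (x1 - y1) (x2 - y2) (x3 - y3) (x4 - y4) (x5 - y5) = F x1 x2 x3 x4 x5 - F y1 y2 y3 y4 y5"
      by (simp add: F_def vec.scale_left_diff_distrib)
    with that show ?thesis
      using indep[of "x1 - y1" "x2 - y2" "x3 - y3" "x4 - y4" "x5 - y5"] by simp
  qed
  then show "F x1 x2 x3 x4 x5 = F y1 y2 y3 y4 y5 \<Longrightarrow> x1 = y1 \<and> x2 = y2 \<and> x3 = y3 \<and> x4 = y4 \<and> x5 = y5" .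
  let ?G = "\<lambda>(x1, x2, x3, x4, x5). F x1 x2 x3 x4 x5"
  have "inj ?G"
    by (rule injI) (auto dest!: inj)
  then have "card (range ?G) = CARD('a \<times> 'a \<times> 'a \<times> 'a \<times> 'a)"
    by (rule card_image)
  also have "\<dots> = CARD('a ^ 5)"
    by (simp add: eval_nat_numeral)
  finally have "range ?G = UNIV"
    by (intro card_subset_eq) auto
  then obtain X where "v = ?G X"
    by blast
  then show "\<exists>x1 x2 x3 x4 x5. v = F x1 x2 x3 x4 x5"
    by (cases X) (simp only: prod.case, blast)
qed

lemma exists_outside_four_combinations:
  fixes e1 e2 e3 e4 :: "'a::{field, finite} ^ 5"
  shows "\<exists>w. \<forall>x1 x2 x3 x4. w \<noteq> x1 *s e1 + x2 *s e2 + x3 *s e3 + x4 *s e4"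
proof (rule ccontr)
  assume contr: "\<not> ?thesis"
  let ?G = "\<lambda>(x1, x2, x3, x4). x1 *s e1 + x2 *s e2 + x3 *s e3 + x4 *s e4"
  have "w \<in> range ?G" for w
  proof -
    obtain x1 x2 x3 x4 where "w = x1 *s e1 + x2 *s e2 + x3 *s e3 + x4 *s e4"
      using contr by blast
    then show ?thesis
      by (intro range_eqI[of _ _ "(x1, x2, x3, x4)"]) simp
  qed
  then have "range ?G = UNIV"
    by blast
  then have "CARD('a ^ 5) \<le> CARD('a \<times> 'a \<times> 'a \<times> 'a)"
    by (metis card_image_le finite_code)
  then have "CARD('a) ^ 5 \<le> CARD('a) ^ 4"
    by (simp add: eval_nat_numeral)
  then show False
    using power_strict_increasing[of 4 5 "CARD('a)"] card_field_ge_2[where 'a = 'a] by simp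
qed

section \<open>Bases of the vertex and hyperbolic pairs\<close>

lemma span_pair: "vec.span {a, b} = {x *s a + y *s b | x y. True}"
  by (auto simp: vec.span_insert vec.span_singleton algebra_simps)

lemma subspace_dim_1:
  assumes "vec.subspace S" "vec.dim S = 1"
  obtains v where "v \<noteq> 0" "S = range (\<lambda>t. t *s v)"
  using assms proj_points_eq unfolding proj_points_def by blast

lemma subspace_dim_2:
  assumes "vec.subspace S" "vec.dim S = 2"
  obtains r1 r2 where "S = {s *s r1 + t *s r2 | s t. True}"
    "\<And>s t. s *s r1 + t *s r2 = 0 \<Longrightarrow> s = 0 \<and> t = 0"
proof -
  obtain B where B: "B \<subseteq> S" "vec.independent B" "S \<subseteq> vec.span B" "card B = vec.dim S"
    by (rule vec.basis_exists)
  then obtain r1 r2 where r: "B = {r1, r2}" "r1 \<noteq> r2"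
    using assms(2) card_2_iff by metis
  have "S = vec.span {r1, r2}"
    using B(1,3) assms(1) r(1) by (metis subset_antisym vec.span_minimal)
  moreover have "s = 0 \<and> t = 0" if "s *s r1 + t *s r2 = 0" for s t
  proof -
    have ind: "r1 \<notin> vec.span {r2}" "r2 \<notin> vec.span {r1}"
      using B(2) r unfolding vec.dependent_def by (auto simp: insert_Diff_if)
    have "s = 0"
    proof (rule ccontr)
      assume "s \<noteq> 0"
      have "s *s r1 = (- t) *s r2"
        using that by (simp add: eq_neg_iff_add_eq_0)
      then have "inverse s *s (s *s r1) = inverse s *s ((- t) *s r2)"
        by simp
      then have "r1 = (inverse s * (- t)) *s r2"
        using \<open>s \<noteq> 0\<close> by simp
      with ind(1) show False
        unfolding vec.span_singleton by blast
    qed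
    moreover have "r2 \<noteq> 0"
      using ind(2) vec.span_zero by metis
    ultimately show ?thesis
      using that by simp
  qed
  ultimately show ?thesis
    using that unfolding span_pair by blast
qed

text \<open>A singular vector off the radical has a partner \<open>e3\<close> forming a hyperbolic
  pair. Modulo the radical the orthogonal complement of the pair is a line, spanned by
  \<open>e2\<close>, and \<open>k\<close> is \<open>Q e2\<close>. In characteristic 2 this
  \<open>e2\<close> is the nucleus of the conic, orthogonal to everything yet not radical.\<close>

lemma rank_3_normal_form:
  fixes Q :: "'a::{field, finite} ^ 5 \<Rightarrow> 'a"
  assumes Q: "quadratic_map Q"
    and rad: "radical Q = {s *s r1 + t *s r2 | s t. True}"
    and r: "\<And>s t. s *s r1 + t *s r2 = 0 \<Longrightarrow> s = 0 \<and> t = 0"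
    and e1: "Q e1 = 0" "e1 \<notin> radical Q"
  obtains e2 e3 k where "k \<noteq> 0"
    "\<And>x y z s t. x *s e1 + y *s e2 + z *s e3 + s *s r1 + t *s r2 = 0 \<Longrightarrow>
      x = 0 \<and> y = 0 \<and> z = 0 \<and> s = 0 \<and> t = 0"
    "\<And>x y z s t. Q (x *s e1 + y *s e2 + z *s e3 + s *s r1 + t *s r2) = x * z + k * y\<^sup>2"
proof -
  note simps = quadratic_map_simps[OF Q]
  have in_rad: "r1 \<in> radical Q" "r2 \<in> radical Q"
  proof -
    show "r1 \<in> radical Q"
      unfolding rad by (intro CollectI exI[of _ 1] exI[of _ 0]) simp
    show "r2 \<in> radical Q"
      unfolding rad by (intro CollectI exI[of _ 0] exI[of _ 1]) simp
  qed
  have r0: "Q r1 = 0" "Q r2 = 0" "polar Q x r1 = 0" "polar Q x r2 = 0"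
    "polar Q r1 x = 0" "polar Q r2 x = 0" for x
    using in_rad unfolding radical_iff[OF Q] by (auto simp: polar_commute[of Q r1] polar_commute[of Q r2])
  have e11: "polar Q e1 e1 = 0"
    using polar_self[OF Q, of e1] e1(1) by simp
  obtain u where "polar Q u e1 \<noteq> 0"
    using e1 unfolding radical_iff[OF Q] by blast
  then have u: "polar Q e1 u \<noteq> 0"
    by (simp add: polar_commute)
  define u' where "u' = inverse (polar Q e1 u) *s u"
  have u': "polar Q e1 u' = 1" "polar Q u' e1 = 1"
    using u by (simp_all add: u'_def simps polar_commute[of Q u])
  \<comment> \<open>\<open>Q (u' - c *s e1) = Q u' - c\<close>, so \<open>c = Q u'\<close> makes
    \<open>e3\<close> singular without changing its product with \<open>e1\<close>.\<close>
  define e3 where "e3 = u' - Q u' *s e1"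
  have e3: "Q e3 = 0" "polar Q e1 e3 = 1" "polar Q e3 e1 = 1"
    by (simp_all add: e3_def simps u' e1(1) e11)
  have e33: "polar Q e3 e3 = 0"
    using polar_self[OF Q, of e3] e3(1) by simp
  obtain w where w: "\<And>a b c d. w \<noteq> a *s e1 + b *s e3 + c *s r1 + d *s r2"
    using exists_outside_four_combinations[of e1 e3 r1 r2] by blast
  \<comment> \<open>Projection away from the hyperbolic pair: the component along \<open>e1\<close>
    is read off by pairing with \<open>e3\<close>, and conversely.\<close>
  define e2 where "e2 = w - polar Q w e3 *s e1 - polar Q w e1 *s e3"
  have e2: "polar Q e2 e1 = 0" "polar Q e2 e3 = 0" "polar Q e1 e2 = 0" "polar Q e3 e2 = 0"
  proof -
    show "polar Q e2 e1 = 0" "polar Q e2 e3 = 0"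
      by (simp_all add: e2_def simps e11 e33 e3)
    then show "polar Q e1 e2 = 0" "polar Q e3 e2 = 0"
      by (simp_all add: polar_commute)
  qed
  have indep: "x = 0 \<and> y = 0 \<and> z = 0 \<and> s = 0 \<and> t = 0"
    if 0: "x *s e1 + y *s e2 + z *s e3 + s *s r1 + t *s r2 = 0" for x y z s t
  proof -
    have "polar Q (x *s e1 + y *s e2 + z *s e3 + s *s r1 + t *s r2) e3 = 0"
      unfolding 0 by (simp add: simps)
    then have x: "x = 0"
      by (simp add: simps e2 e3 e33 r0)
    have "polar Q (x *s e1 + y *s e2 + z *s e3 + s *s r1 + t *s r2) e1 = 0"
      unfolding 0 by (simp add: simps)
    then have z: "z = 0"
      by (simp add: simps e2 e3 e11 r0)
    have y: "y = 0"
    proof (rule ccontr)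
      assume y: "y \<noteq> 0"
      have "y *s e2 = (- s) *s r1 + (- t) *s r2"
        using 0 x z by (simp add: algebra_simps eq_neg_iff_add_eq_0)
      then have "inverse y *s (y *s e2) = inverse y *s ((- s) *s r1 + (- t) *s r2)"
        by simp
      then have "e2 = (inverse y * (- s)) *s r1 + (inverse y * (- t)) *s r2"
        using y by (simp add: vec.scale_right_distrib vec.scale_right_diff_distrib)
      then have "w = polar Q w e3 *s e1 + polar Q w e1 *s e3 + (inverse y * (- s)) *s r1 + (inverse y * (- t)) *s r2"
        unfolding e2_def by (simp add: algebra_simps)
      with w show False by blast
    qed
    with 0 x z r show ?thesis by simp
  qed
  \<comment> \<open>Otherwise \<open>polar Q e2 e2 = 2 * Q e2\<close> vanishes too,
    \<open>e2\<close> is orthogonal to the whole basis and hence radical, against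
    independence.\<close>
  have "Q e2 \<noteq> 0"
  proof
    assume Q0: "Q e2 = 0"
    have "polar Q e2 e2 = 0"
      using polar_self[OF Q, of e2] Q0 by simp
    have "polar Q v e2 = 0" for v
    proof -
      obtain x y z s t where "v = x *s e1 + y *s e2 + z *s e3 + s *s r1 + t *s r2"
        using five_independent_coordinates(2)[OF indep] by blast
      then show ?thesis
        by (simp add: simps e2 r0 \<open>polar Q e2 e2 = 0\<close>)
    qed
    then have "e2 \<in> radical Q"
      using Q0 by (simp add: radical_iff[OF Q])
    then obtain s t where "e2 = s *s r1 + t *s r2"
      unfolding rad by blast
    then have "0 *s e1 + 1 *s e2 + 0 *s e3 + (- s) *s r1 + (- t) *s r2 = 0"
      by simp
    then show False
      using indep by (metis one_neq_zero)
  qed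
  moreover have "Q (x *s e1 + y *s e2 + z *s e3 + s *s r1 + t *s r2) = x * z + Q e2 * y\<^sup>2" for x y z s t
    by (simp add: simps e1(1) e2 e3 r0)
  ultimately show ?thesis
    using that indep by blast
qed

text \<open>Without such an \<open>f\<close>, every vector orthogonal to \<open>b\<close> is
  orthogonal to \<open>a\<close>, so the functionals \<open>polar Q a\<close> and
  \<open>polar Q b\<close> are proportional. Then some \<open>a - c *s b\<close> is orthogonal to
  everything and, being singular, radical.\<close>

lemma dual_vector:
  assumes Q: "quadratic_map Q"
    and "Q b = 0" "b \<notin> radical Q"
    and "\<And>c. Q (a - c *s b) = 0" "\<And>c. a - c *s b \<notin> radical Q"
  shows "\<exists>f. polar Q a f = 1 \<and> polar Q b f = 0"
proof (rule ccontr)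
  assume contr: "\<not> ?thesis"
  note simps = quadratic_map_simps[OF Q]
  have perp: "polar Q a x = 0" if "polar Q b x = 0" for x
  proof (rule ccontr)
    assume "polar Q a x \<noteq> 0"
    then have "polar Q a (inverse (polar Q a x) *s x) = 1 \<and> polar Q b (inverse (polar Q a x) *s x) = 0"
      using that by (simp add: simps)
    with contr show False by blast
  qed
  obtain u where "polar Q u b \<noteq> 0"
    using assms(2,3) unfolding radical_iff[OF Q] by blast
  then have u: "polar Q b u \<noteq> 0"
    by (simp add: polar_commute)
  let ?c = "polar Q a u / polar Q b u"
  have "polar Q x (a - ?c *s b) = 0" for x
  proof -
    have "polar Q b (x - (polar Q b x / polar Q b u) *s u) = 0"
      using u by (simp add: simps)
    then have "polar Q a (x - (polar Q b x / polar Q b u) *s u) = 0"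
      by (rule perp)
    then show ?thesis
      by (simp add: simps polar_commute[of Q x])
  qed
  then have "a - ?c *s b \<in> radical Q"
    using assms(4) by (simp add: radical_iff[OF Q])
  with assms(5) show False by blast
qed

text \<open>As \<open>W\<close> has dimension 3 and the radical dimension 1, \<open>W\<close>
  contains \<open>e1\<close>, \<open>e2\<close> independent modulo the radical. They span a totally
  singular plane of vectors; dual vectors complete it to two orthogonal hyperbolic pairs.\<close>

lemma rank_4_normal_form:
  fixes Q :: "'a::{field, finite} ^ 'n::finite \<Rightarrow> 'a"
  assumes Q: "quadratic_map Q"
    and rad: "radical Q = range (\<lambda>t. t *s v)" and v: "v \<noteq> 0"
    and W: "vec.subspace W" "vec.dim W = 3" "\<And>x. x \<in> W \<Longrightarrow> Q x = 0"
  obtains e1 f1 e2 f2 where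
    "\<And>x1 y1 x2 y2 t. x1 *s e1 + y1 *s f1 + x2 *s e2 + y2 *s f2 + t *s v = 0 \<Longrightarrow>
      x1 = 0 \<and> y1 = 0 \<and> x2 = 0 \<and> y2 = 0 \<and> t = 0"
    "\<And>x1 y1 x2 y2 t. Q (x1 *s e1 + y1 *s f1 + x2 *s e2 + y2 *s f2 + t *s v) = x1 * y1 + x2 * y2"
proof -
  note simps = quadratic_map_simps[OF Q]
  have "v \<in> radical Q"
    unfolding rad by (rule range_eqI[of _ _ 1]) simp
  then have v0: "Q v = 0" "polar Q x v = 0" "polar Q v x = 0" for x
    unfolding radical_iff[OF Q] by (auto simp: polar_commute[of Q v])
  have "\<not> W \<subseteq> vec.span {v}"
    using vec.dim_le_card[of W "{v}"] W(2) by auto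
  then obtain e1 where e1: "e1 \<in> W" "e1 \<notin> vec.span {v}"
    by blast
  have "card {e1, v} \<le> 2"
    by (simp add: card_insert_if)
  then have "\<not> W \<subseteq> vec.span {e1, v}"
    using vec.dim_le_card[of W "{e1, v}"] W(2) by auto
  then obtain e2 where e2: "e2 \<in> W" "e2 \<notin> vec.span {e1, v}"
    by blast
  have span: "vec.span {v} = radical Q"
    by (simp add: rad vec.span_singleton)
  have nrad1: "e1 \<notin> radical Q" and nrad2: "e2 \<notin> radical Q"
    using e1(2) e2(2) vec.span_mono[of "{v}" "{e1, v}"] by (auto simp: span)
  have nrad21: "e2 - c *s e1 \<notin> radical Q" for c
    using e2(2) unfolding vec.span_insert[of e1] span by blast
  have nrad12: "e1 - c *s e2 \<notin> radical Q" for c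
  proof
    assume *: "e1 - c *s e2 \<in> radical Q"
    show False
    proof (cases "c = 0")
      case True
      with * nrad1 show False by simp
    next
      case False
      then have "e2 - inverse c *s e1 = (- inverse c) *s (e1 - c *s e2)"
        by (simp add: vec.scale_right_diff_distrib)
      then have "e2 - inverse c *s e1 \<in> radical Q"
        using * vec.subspace_scale[OF subspace_radical[OF Q]] by metis
      with nrad21 show False by blast
    qed
  qed
  have W_comb: "Q (a *s e1 + b *s e2) = 0" for a b
    using W e1(1) e2(1) by (simp add: vec.subspace_add vec.subspace_scale)
  have Qe: "Q e1 = 0" "Q e2 = 0"
    using W(3) e1(1) e2(1) by auto
  have e12: "polar Q e1 e2 = 0" "polar Q e2 e1 = 0"
    using W_comb[of 1 1] Qe by (simp_all add: simps polar_commute[of Q e2 e1])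
  have self: "polar Q e1 e1 = 0" "polar Q e2 e2 = 0"
    using polar_self[OF Q] Qe by simp_all
  obtain g1 where g1: "polar Q e1 g1 = 1" "polar Q e2 g1 = 0"
    using dual_vector[OF Q Qe(2) nrad2 _ nrad12] W_comb[of 1 "- c" for c] by auto
  obtain g2 where g2: "polar Q e2 g2 = 1" "polar Q e1 g2 = 0"
    using dual_vector[OF Q Qe(1) nrad1 _ nrad21] W_comb[of "- c" 1 for c] by auto
  have g1': "polar Q g1 e1 = 1" "polar Q g1 e2 = 0" and g2': "polar Q g2 e2 = 1" "polar Q g2 e1 = 0"
    using g1 g2 by (simp_all add: polar_commute)
  define f1 where "f1 = g1 - Q g1 *s e1"
  have f1: "Q f1 = 0" "polar Q e1 f1 = 1" "polar Q e2 f1 = 0" "polar Q f1 e1 = 1" "polar Q f1 e2 = 0"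
    by (simp_all add: f1_def simps g1 g1' Qe e12 self)
  define h2 where "h2 = g2 - Q g2 *s e2"
  have h2: "Q h2 = 0" "polar Q e1 h2 = 0" "polar Q e2 h2 = 1" "polar Q h2 e1 = 0" "polar Q h2 e2 = 1"
    by (simp_all add: h2_def simps g2 g2' Qe e12 self)
  \<comment> \<open>The multiple of \<open>e1\<close> makes \<open>f2\<close> orthogonal to
    \<open>f1\<close>, since \<open>polar Q f1 e1 = 1\<close>. It stays singular because
    \<open>h2\<close> is orthogonal to \<open>e1\<close>.\<close>
  define f2 where "f2 = h2 - polar Q f1 h2 *s e1"
  have f2: "Q f2 = 0" "polar Q e1 f2 = 0" "polar Q e2 f2 = 1" "polar Q f2 e1 = 0" "polar Q f2 e2 = 1"
    "polar Q f1 f2 = 0"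
    by (simp_all add: f2_def simps h2 f1 Qe e12 self)
  have f21: "polar Q f2 f1 = 0" and ff: "polar Q f1 f1 = 0" "polar Q f2 f2 = 0"
    using f2 f1 polar_self[OF Q] by (simp_all add: polar_commute[of Q f2 f1])
  note table = Qe e12 self f1 f2 f21 ff v0
  let ?F = "\<lambda>x1 y1 x2 y2 t. x1 *s e1 + y1 *s f1 + x2 *s e2 + y2 *s f2 + t *s v"
  have "x1 = 0 \<and> y1 = 0 \<and> x2 = 0 \<and> y2 = 0 \<and> t = 0" if 0: "?F x1 y1 x2 y2 t = 0" for x1 y1 x2 y2 t
  proof -
    have "polar Q (?F x1 y1 x2 y2 t) w = 0" for w
      unfolding 0 by (simp add: simps)
    from this[of f1] this[of e1] this[of f2] this[of e2]
    have *: "x1 = 0" "y1 = 0" "x2 = 0" "y2 = 0"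
      by (simp_all add: simps table)
    then show ?thesis
      using 0 v by simp
  qed
  moreover have "Q (?F x1 y1 x2 y2 t) = x1 * y1 + x2 * y2" for x1 y1 x2 y2 t
    by (simp add: simps table)
  ultimately show ?thesis
    by (rule that)
qed

text \<open>All singular vectors lie in the radical, spanned by two vectors, so at most
  \<open>q^2 - 1 = (q - 1) * (q + 1)\<close> of them are nonzero.\<close>

lemma card_points_anisotropic_rank_3:
  fixes Q1 Q2 :: "'a::{field, finite} ^ 'n::finite \<Rightarrow> 'a"
  assumes Q1: "quadratic_map Q1" and Q2: "quadratic_map Q2"
    and rad: "radical Q1 = {s *s r1 + t *s r2 | s t. True}"
    and aniso: "\<And>v. Q1 v = 0 \<Longrightarrow> v \<in> radical Q1"
  shows "card {P \<in> proj_points. P \<subseteq> {v. Q1 v = 0 \<and> Q2 v = 0}} \<le> CARD('a) + 1"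
proof -
  let ?q = "CARD('a)"
  let ?S = "{v. Q1 v = 0 \<and> Q2 v = 0}"
  have "?S \<subseteq> range (\<lambda>(s, t). s *s r1 + t *s r2)"
    using aniso unfolding rad by force
  then have "card ?S \<le> card (range (\<lambda>(s, t). s *s r1 + t *s r2))"
    by (intro card_mono) auto
  also have "\<dots> \<le> CARD('a \<times> 'a)"
    by (rule card_image_le) simp
  finally have "card ?S \<le> ?q * ?q"
    by simp
  moreover have "0 \<in> ?S"
    using Q1 Q2 by (simp add: quadratic_map_zero)
  ultimately have "card (?S - {0}) \<le> ?q * ?q - 1"
    by (simp add: card_Diff_singleton)
  also have "\<dots> = (?q - 1) * (?q + 1)"
    by (simp add: algebra_simps)
  finally have "(?q - 1) * card {P \<in> proj_points. P \<subseteq> ?S} \<le> (?q - 1) * (?q + 1)"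
    using card_proj_points_subset[of ?S] Q1 Q2 by (simp add: quadratic_map_zero quadratic_map_scale)
  moreover have "0 < ?q - 1"
    using card_field_ge_2[where 'a = 'a] by simp
  ultimately show ?thesis
    by (simp only: nat_mult_le_cancel1)
qed

section \<open>Back to polynomials and the final assembly\<close>

lemma zero_set_Int:
  "zero_set f \<inter> zero_set g = {P \<in> proj_points. P \<subseteq> {v. eval_poly f v = 0 \<and> eval_poly g v = 0}}"
  by (auto simp: zero_set_def)

text \<open>The theorem excludes scalar multiples among formal polynomials, the counting excludes
  them among functions; this bridges the two.\<close>

lemma eval_poly_multiple_imp:
  fixes f g :: "('a::field, 'n::finite) mvpoly"
  assumes "homogeneous 2 f" "homogeneous 2 g" "\<And>v. eval_poly f v = c * eval_poly g v"
  shows "f = Const c * g"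
proof -
  have "homogeneous 2 (Const c * g)"
    using homogeneous_mult[OF homogeneous_Const assms(2), of c] by (simp only: add_0)
  then have "homogeneous 2 (f - Const c * g)"
    by (rule homogeneous_diff[OF assms(1)])
  moreover have "eval_poly (f - Const c * g) v = 0" for v
  proof -
    have "eval_poly f v = eval_poly ((f - Const c * g) + Const c * g) v"
      by simp
    then show ?thesis
      unfolding eval_poly_add eval_poly_mult using assms(3) by simp
  qed
  ultimately have "f - Const c * g = 0"
    by (rule eval_poly_eq_0_imp)
  then show ?thesis by simp
qed

theorem theorem4p3:
  fixes f\<^sub>X f :: "('a::{field, finite}, 5) mvpoly"
    and q :: nat
  assumes "q = CARD('a)"
    and "is_form 2 f\<^sub>X" and "degenerate f\<^sub>X"
    and "is_form 2 f" and "\<nexists>c. f = Const c * f\<^sub>X"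
  shows "(form_rank f\<^sub>X = 3 \<longrightarrow>
            card (zero_set f\<^sub>X \<inter> zero_set f) = 4 * q^2 + q + 1 \<or>
            card (zero_set f\<^sub>X \<inter> zero_set f) \<le> 3 * q^2 + q + 1) \<and>
         (form_rank f\<^sub>X = 4 \<and> projective_index (zero_set f\<^sub>X) = 2 \<longrightarrow>
            card (zero_set f\<^sub>X \<inter> zero_set f) = 4 * q^2 + 1 \<or>
            card (zero_set f\<^sub>X \<inter> zero_set f) \<le> 3 * q^2 + q + 1)"
proof -
  have hom: "homogeneous 2 f\<^sub>X" "homogeneous 2 f"
    using assms(2,4) by (auto simp: is_form_def homogeneous_def)
  note Q = quadratic_map_eval_poly[OF hom(1)] quadratic_map_eval_poly[OF hom(2)]
  have not_multiple: "\<nexists>c. \<forall>v. eval_poly f v = c * eval_poly f\<^sub>X v"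
    using eval_poly_multiple_imp[OF hom(2,1)] assms(5) by blast
  have dim: "form_rank f\<^sub>X + vec.dim (radical (eval_poly f\<^sub>X)) = 5"
    using form_rank_plus_dim_radical[OF hom(1)] by simp
  note subsp = subspace_radical[OF Q(1)]
  show ?thesis
  proof (intro conjI impI)
    assume "form_rank f\<^sub>X = 3"
    with dim have "vec.dim (radical (eval_poly f\<^sub>X)) = 2"
      by simp
    then obtain r1 r2 where rad: "radical (eval_poly f\<^sub>X) = {s *s r1 + t *s r2 | s t. True}"
      and r: "\<And>s t. s *s r1 + t *s r2 = 0 \<Longrightarrow> s = 0 \<and> t = 0"
      using subspace_dim_2[OF subsp] by blast
    show "card (zero_set f\<^sub>X \<inter> zero_set f) = 4 * q^2 + q + 1 \<or>
          card (zero_set f\<^sub>X \<inter> zero_set f) \<le> 3 * q^2 + q + 1"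
    \<comment> \<open>The case distinction is whether the base of the cone has a point.\<close>
    proof (cases "\<exists>e1. eval_poly f\<^sub>X e1 = 0 \<and> e1 \<notin> radical (eval_poly f\<^sub>X)")
      case True
      then obtain e1 where e1: "eval_poly f\<^sub>X e1 = 0" "e1 \<notin> radical (eval_poly f\<^sub>X)"
        by blast
      show ?thesis
      proof (rule rank_3_normal_form[OF Q(1) rad _ e1], erule r)
        fix e2 e3 k
        assume *: "k \<noteq> 0"
          "\<And>x y z s t. x *s e1 + y *s e2 + z *s e3 + s *s r1 + t *s r2 = 0 \<Longrightarrow>
            x = 0 \<and> y = 0 \<and> z = 0 \<and> s = 0 \<and> t = 0"
          "\<And>x y z s t. eval_poly f\<^sub>X (x *s e1 + y *s e2 + z *s e3 + s *s r1 + t *s r2) = x * z + k * y\<^sup>2"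
        show ?thesis
          unfolding zero_set_Int
          by (rule card_points_rank_3[OF Q five_independent_coordinates[OF *(2)] *(3,1) not_multiple assms(1)])
      qed
    next
      case False
      then have "card (zero_set f\<^sub>X \<inter> zero_set f) \<le> q + 1"
        unfolding zero_set_Int assms(1) by (intro card_points_anisotropic_rank_3[OF Q rad]) blast
      then show ?thesis by simp
    qed
  next
    assume rank4: "form_rank f\<^sub>X = 4 \<and> projective_index (zero_set f\<^sub>X) = 2"
    with dim have "vec.dim (radical (eval_poly f\<^sub>X)) = 1"
      by simp
    then obtain v where v: "v \<noteq> 0" and rad: "radical (eval_poly f\<^sub>X) = range (\<lambda>t. t *s v)"
      using subspace_dim_1[OF subsp] by blast
    \<comment> \<open>Projective index 2 is \<open>int 3 - 1\<close>: a plane in projective space is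
      a vector subspace of dimension 3.\<close>
    obtain W where W: "vec.subspace W" "vec.dim W = 3" "\<And>x. x \<in> W \<Longrightarrow> eval_poly f\<^sub>X x = 0"
      using singular_subspace_of_projective_index[of f\<^sub>X 3] rank4 quadratic_map_zero[OF Q(1)] by auto
    show "card (zero_set f\<^sub>X \<inter> zero_set f) = 4 * q^2 + 1 \<or>
          card (zero_set f\<^sub>X \<inter> zero_set f) \<le> 3 * q^2 + q + 1"
    proof (rule rank_4_normal_form[OF Q(1) rad v W(1,2)], erule W(3))
      fix e1 f1 e2 f2
      assume *: "\<And>x1 y1 x2 y2 t. x1 *s e1 + y1 *s f1 + x2 *s e2 + y2 *s f2 + t *s v = 0 \<Longrightarrow>
          x1 = 0 \<and> y1 = 0 \<and> x2 = 0 \<and> y2 = 0 \<and> t = 0"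
        "\<And>x1 y1 x2 y2 t. eval_poly f\<^sub>X (x1 *s e1 + y1 *s f1 + x2 *s e2 + y2 *s f2 + t *s v) = x1 * y1 + x2 * y2"
      show "card (zero_set f\<^sub>X \<inter> zero_set f) = 4 * q^2 + 1 \<or>
          card (zero_set f\<^sub>X \<inter> zero_set f) \<le> 3 * q^2 + q + 1"
        unfolding zero_set_Int
        by (rule card_points_rank_4[OF Q five_independent_coordinates[OF *(1)] *(2) not_multiple assms(1)])
    qed
  qed
qed

end
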